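(* Let $\mathcal{L}\subseteq\{+,-,0\}^E$ be the set of covectors of a loopless oriented matroid on a finite ground set $E$, let $M=\mathrm{Mat}(\mathcal{L})$ be its underlying matroid, let $\mathbb{K}$ be a field, and let $\mathfrak{V}$ be the Varchenko matrix of $\mathcal{L}$ over $\mathbb{K}[U_e\mid e\in E]$. Then $$\det(\mathfrak{V})=\prod_{\substack{A\subseteq E\\ A\text{ closed in }M}}\Bigl(1-\prod_{e\in A}U_e^2\Bigr)^{m_A},$$ where $m_A$ is the product of the number of topes of the contraction $\mathcal{L}/A$ and of $\beta(\mathrm{Mat}(\mathcal{L}|_A))$. In particular, $\det(\mathfrak{V})$ depends only on the matroid $M$.
   Context: Oriented matroids are given by their covector sets (standard covector axioms). Covectors are ordered componentwise by $0<+$, $0<-$; topes are the maximal covectors. Loopless means that for every $e\in E$ some covector $X$ has $X_e\ne0$. For topes $P,Q$, $\mathrm{Sep}(P,Q)=\{e\in E\mid P_e=-Q_e\neq 0\}$. The Varchenko matrix $\mathfrak{V}$ has rows and columns indexed by the set of topes, with entries $\mathfrak{V}_{P,Q}=\prod_{e\in \mathrm{Sep}(P,Q)}U_e$. For a covector $F$, $z(F)=\{e\in E\mid F_e=0\}$. The closed sets (flats) of $M=\mathrm{Mat}(\mathcal{L})$ are exactly the sets $z(F)$, $F\in\mathcal{L}$. Restriction: $\mathcal{L}|_A=\{(F_e)_{e\in A}\mid F\in\mathcal{L}\}$. Contraction: $\mathcal{L}/A=\{(F_e)_{e\in E\setminus A}\mid F\in\mathcal{L},\ A\subseteq z(F)\}$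 (so for closed $A$ its number of topes is the number of $F\in\mathcal{L}$ with $z(F)=A$; it is $1$ for $A=E$). $\beta(N)$ is Crapo's beta invariant of a matroid $N$ on ground set $A$, $\beta(N)=(-1)^{r(N)}\sum_{B\subseteq A}(-1)^{|B|}r_N(B)$; in particular $\beta$ of the empty matroid is $0$, and the convention $0^0=1$ is used for the factor $A=\emptyset$. *)

theory Defs
  imports "HOL-Library.Poly_Mapping" "Jordan_Normal_Form.Determinant"
begin

datatype sign = Zero | Pos | Neg

instantiation sign :: uminus
begin

fun uminus_sign :: "sign \<Rightarrow> sign" where
  "- Zero = Zero"
| "- Pos = Neg"
| "- Neg = Pos"

instance ..

end

instantiation sign :: order
begin

definition less_eq_sign :: "sign \<Rightarrow> sign \<Rightarrow> bool" where
  "s \<le> t \<longleftrightarrow> s = Zero \<or> s = (t :: sign)"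

definition less_sign :: "sign \<Rightarrow> sign \<Rightarrow> bool" where
  "s < t \<longleftrightarrow> s = Zero \<and> t \<noteq> (Zero :: sign)"

instance
  by standard (auto simp: less_eq_sign_def less_sign_def)

end

text \<open>
  A sign vector on a ground set \<open>E\<close>, i.e. an element of \<open>{+,-,0}\<close> to the power \<open>E\<close>, is
  represented by a function on the whole type that vanishes outside \<open>E\<close>. Negation and the
  componentwise order are the pointwise ones that HOL provides on functions.
\<close>

type_synonym 'e sign_vector = "'e \<Rightarrow> sign"

definition sign_vectors :: "'e set \<Rightarrow> 'e sign_vector set" where
  "sign_vectors E = {X. \<forall>e. e \<notin> E \<longrightarrow> X e = Zero}"

definition compose :: "'e sign_vector \<Rightarrow> 'e sign_vector \<Rightarrow> 'e sign_vector" where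
  "compose X Y = (\<lambda>e. if X e \<noteq> Zero then X e else Y e)"

definition Sep :: "'e sign_vector \<Rightarrow> 'e sign_vector \<Rightarrow> 'e set" where
  "Sep X Y = {e. X e = - Y e \<and> X e \<noteq> Zero}"

definition zero_set :: "'e set \<Rightarrow> 'e sign_vector \<Rightarrow> 'e set" where
  "zero_set E F = {e \<in> E. F e = Zero}"

locale oriented_matroid =
  fixes E :: "'e set" and L :: "'e sign_vector set"
  assumes finite_ground: "finite E"
    and covectors: "L \<subseteq> sign_vectors E"
    and zero: "(\<lambda>_. Zero) \<in> L"
    and symmetry: "X \<in> L \<Longrightarrow> - X \<in> L"
    and composition: "X \<in> L \<Longrightarrow> Y \<in> L \<Longrightarrow> compose X Y \<in> L"
    and elimination: "X \<in> L \<Longrightarrow> Y \<in> L \<Longrightarrow> e \<in> Sep X Y \<Longrightarrow>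
      \<exists>Z\<in>L. Z e = Zero \<and> (\<forall>f \<in> E - Sep X Y. Z f = compose X Y f)"

locale loopless_oriented_matroid = oriented_matroid +
  assumes loopless: "e \<in> E \<Longrightarrow> \<exists>X\<in>L. X e \<noteq> Zero"

definition topes :: "'e sign_vector set \<Rightarrow> 'e sign_vector set" where
  "topes L = {P \<in> L. \<forall>F\<in>L. P \<le> F \<longrightarrow> F = P}"

definition restriction :: "'e sign_vector set \<Rightarrow> 'e set \<Rightarrow> 'e sign_vector set" where
  "restriction L A = (\<lambda>F e. if e \<in> A then F e else Zero) ` L"

definition contraction :: "'e set \<Rightarrow> 'e sign_vector set \<Rightarrow> 'e set \<Rightarrow> 'e sign_vector set" where
  "contraction E L A = restriction {F \<in> L. A \<subseteq> zero_set E F} (E - A)"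

text \<open>
  A matroid is represented by its ground set and its collection of flats; closure,
  independence and rank are derived from the flats in the standard way.
\<close>

record 'e matroid =
  ground :: "'e set"
  flats :: "'e set set"

definition closure_of_set :: "'e matroid \<Rightarrow> 'e set \<Rightarrow> 'e set" where
  "closure_of_set M B = \<Inter> {A \<in> flats M. B \<subseteq> A}"

definition independent :: "'e matroid \<Rightarrow> 'e set \<Rightarrow> bool" where
  "independent M I \<longleftrightarrow> I \<subseteq> ground M \<and> (\<forall>e\<in>I. e \<notin> closure_of_set M (I - {e}))"

definition matroid_rank :: "'e matroid \<Rightarrow> 'e set \<Rightarrow> nat" where
  "matroid_rank M B = Max (card ` {I. I \<subseteq> B \<and> independent M I})"

definition crapo_beta :: "'e matroid \<Rightarrow> int" where
  "crapo_beta M = (- 1) ^ matroid_rank M (ground M) *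
     (\<Sum>B\<in>Pow (ground M). (- 1) ^ card B * int (matroid_rank M B))"

definition Mat :: "'e set \<Rightarrow> 'e sign_vector set \<Rightarrow> 'e matroid" where
  "Mat E L = \<lparr>ground = E, flats = zero_set E ` L\<rparr>"

definition flat_multiplicity :: "'e set \<Rightarrow> 'e sign_vector set \<Rightarrow> 'e set \<Rightarrow> int" where
  "flat_multiplicity E L A =
     int (card (topes (contraction E L A))) * crapo_beta (Mat A (restriction L A))"

text \<open>
  Polynomials over \<open>'k\<close> in the variables \<open>U e\<close>, as finitely supported functions
  from monomials (finitely supported exponent functions) to coefficients, with the convolution
  product. The variables range over the whole type \<open>'e\<close>; only those with index in the ground
  set occur in the Varchenko matrix.
\<close>

type_synonym ('e, 'k) mpoly = "('e \<Rightarrow>\<^sub>0 nat) \<Rightarrow>\<^sub>0 'k"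

definition U :: "'e \<Rightarrow> ('e, 'k :: field) mpoly" where
  "U e = Poly_Mapping.single (Poly_Mapping.single e 1) 1"

text \<open>
  The matrices of \<open>Jordan_Normal_Form\<close> are indexed by numbers, so the Varchenko matrix is taken
  with respect to an enumeration \<open>Ps\<close> of the topes without repetition.
\<close>

definition varchenko_matrix :: "'e sign_vector list \<Rightarrow> ('e, 'k :: field) mpoly mat" where
  "varchenko_matrix Ps =
     mat (length Ps) (length Ps) (\<lambda>(i, j). \<Prod>e\<in>Sep (Ps ! i) (Ps ! j). U e)"

end

theory Submission
  imports Defs
begin

text \<open>
  Fix \<open>e\<close> and let \<open>F\<^sub>D\<close> be the largest face of a tope \<open>D\<close> with \<open>e\<close>-entry zero. Around a face \<open>F\<close>
  the Varchenko matrix factors as \<open>v(P,Q) = v(P,FP) v(FP,Q)\<close> for \<open>Q \<ge> F\<close>, so the column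
  \<open>P \<mapsto> v(P,D) [FP = D]\<close> is a combination of the columns of topes above \<open>F\<close>. Summing these columns
  with signs over the faces \<open>F\<close> with \<open>F\<^sub>D < F \<le> D\<close>, all of which lie on the side of \<open>D\<close>, an
  Euler characteristic computation leaves only the contributions of \<open>D\<close> and of the tope opposite
  to \<open>D\<close> around \<open>F\<^sub>D\<close>. Comparing determinants, the determinant gets multiplied by
  \<open>1 - \<Prod>U\<^sub>i\<^sup>2\<close> (with \<open>i\<close> ranging over the zero set of \<open>F\<^sub>D\<close>), once for each \<open>D\<close> on the positive
  side of \<open>e\<close>, when \<open>U\<^sub>e\<close> is restored from \<open>0\<close>. The number of \<open>D\<close> with a given \<open>F\<^sub>D\<close> is the beta
  invariant by an Euler characteristic count of relatively bounded faces, so restoring the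
  variables one at a time gives the product formula.
\<close>

section \<open>Rank from the exchange property of flats\<close>

lemma closure_mono: "B \<subseteq> C \<Longrightarrow> closure_of_set M B \<subseteq> closure_of_set M C"
  unfolding closure_of_set_def by blast

lemma closure_extensive: "B \<subseteq> closure_of_set M B"
  unfolding closure_of_set_def by blast

lemma closure_least: "C \<subseteq> closure_of_set M B \<Longrightarrow> closure_of_set M C \<subseteq> closure_of_set M B"
  unfolding closure_of_set_def by blast

text \<open>Closure is an intersection of flats, so it is monotone, extensive and idempotent for any
  family of sets; Steinitz exchange is the one matroid property to be demanded. The locale serves
  both the matroid of \<open>L\<close> and its restrictions.\<close>

locale exchange_flats =
  fixes M :: "'e matroid"
  assumes finite_ground: "finite (ground M)"
    and exchange: "\<lbrakk>B \<subseteq> ground M; e \<in> ground M; f \<in> ground M; f \<in> closure_of_set M (insert e B);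
      f \<notin> closure_of_set M B\<rbrakk> \<Longrightarrow> e \<in> closure_of_set M (insert f B)"
begin

lemma independent_insert:
  assumes "independent M I" "e \<in> ground M" "e \<notin> closure_of_set M I"
  shows "independent M (insert e I)"
  unfolding independent_def
proof (intro conjI ballI notI)
  fix x assume x: "x \<in> insert e I" "x \<in> closure_of_set M (insert e I - {x})"
  have "e \<notin> I" using assms(3) closure_extensive[of I M] by blast
  show False
  proof (cases "x = e")
    case True
    then show False using x assms(3) \<open>e \<notin> I\<close> by (simp add: insert_Diff_if)
  next
    case False
    then have "x \<in> I" and eq: "insert e I - {x} = insert e (I - {x})" using x by auto
    then have *: "I - {x} \<subseteq> ground M" "x \<in> ground M" "x \<notin> closure_of_set M (I - {x})"
      using assms(1) by (auto simp: independent_def)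
    then have "e \<in> closure_of_set M (insert x (I - {x}))"
      using exchange[OF *(1) assms(2) *(2) x(2)[unfolded eq] *(3)] by simp
    then show False using \<open>x \<in> I\<close> assms(3) by (simp add: insert_absorb)
  qed
qed (use assms in \<open>auto simp: independent_def\<close>)

text \<open>Steinitz exchange: an element of \<open>I\<close> outside \<open>J\<close> is dropped or
  traded for an element of \<open>J\<close>, while \<open>I\<close> keeps spanning \<open>J\<close>.
  Each such move shrinks \<open>I - J\<close>.\<close>

lemma card_independent_le:
  assumes "independent M J" "I \<subseteq> ground M" "J \<subseteq> closure_of_set M I"
  shows "card J \<le> card I"
  using assms(2,3)
proof (induction "card (I - J)" arbitrary: I rule: less_induct)
  case less
  have finI: "finite I" using less.prems finite_ground finite_subset by blast
  have Jg: "J \<subseteq> ground M" using assms(1) by (auto simp: independent_def)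
  show ?case
  proof (cases "I \<subseteq> J")
    case True
    \<comment> \<open>Here \<open>I\<close> is a subset of \<open>J\<close> that spans it, so an
      element of \<open>J\<close> missing from \<open>I\<close> would lie in the closure of the
      others.\<close>
    have "J \<subseteq> I"
    proof
      fix j assume j: "j \<in> J"
      show "j \<in> I"
      proof (rule ccontr)
        assume "j \<notin> I"
        then have "closure_of_set M I \<subseteq> closure_of_set M (J - {j})"
          using True by (intro closure_mono) auto
        then show False using j less.prems assms(1) by (auto simp: independent_def)
      qed
    qed
    then show ?thesis using finI card_mono by blast
  next
    case False
    then obtain x where x: "x \<in> I" "x \<notin> J" by blast
    let ?I' = "I - {x}"
    have smaller: "card (?I' - J) < card (I - J)"
      using x finI by (intro psubset_card_mono) auto
    show ?thesis
    proof (cases "J \<subseteq> closure_of_set M ?I'")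
      case True
      then have "card J \<le> card ?I'" using less.hyps[OF smaller] less.prems by blast
      then show ?thesis using card_mono[OF finI, of ?I'] by auto
    next
      case False
      then obtain j where j: "j \<in> J" "j \<notin> closure_of_set M ?I'" by blast
      \<comment> \<open>Trading \<open>x\<close> for \<open>j\<close>: exchange puts
        \<open>x\<close> into the closure of \<open>?K\<close>, so nothing spanned by
        \<open>I\<close> is lost.\<close>
      let ?K = "insert j ?I'"
      have "j \<in> closure_of_set M (insert x ?I')"
        using j less.prems x by (auto simp: insert_absorb)
      moreover have "?I' \<subseteq> ground M" "x \<in> ground M" "j \<in> ground M"
        using j(1) x(1) less.prems(1) Jg by auto
      ultimately have "x \<in> closure_of_set M ?K"
        using exchange[of ?I' x j] j(2) by simp
      moreover have "?I' \<subseteq> closure_of_set M ?K" by (rule order.trans[OF _ closure_extensive]) auto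
      ultimately have "I \<subseteq> closure_of_set M ?K" by blast
      then have "J \<subseteq> closure_of_set M ?K"
        using less.prems(2) closure_least by blast
      moreover have "card (?K - J) < card (I - J)" using smaller j by (simp add: insert_Diff_if)
      moreover have "?K \<subseteq> ground M" using less.prems j Jg by auto
      ultimately have "card J \<le> card ?K" using less.hyps by blast
      also have "\<dots> \<le> card I"
        using card_Suc_Diff1[OF finI x(1)] card_insert_if[of ?I' j] finI by auto
      finally show ?thesis .
    qed
  qed
qed

lemma matroid_rank_eq_card:
  assumes "B \<subseteq> ground M" "I \<subseteq> B" "independent M I" "B \<subseteq> closure_of_set M I"
  shows "matroid_rank M B = card I"
  unfolding matroid_rank_def
proof (rule Max_eqI)
  have "finite B" using assms(1) finite_ground finite_subset by blast
  then show "finite (card ` {I. I \<subseteq> B \<and> independent M I})" by simp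
  show "y \<le> card I" if "y \<in> card ` {I. I \<subseteq> B \<and> independent M I}" for y
    using that assms card_independent_le[of _ I] by auto
qed (use assms in auto)

lemma obtain_basis:
  assumes "B \<subseteq> ground M"
  obtains I where "I \<subseteq> B" "independent M I" "B \<subseteq> closure_of_set M I"
proof -
  have "finite B" using assms finite_ground finite_subset by blast
  then have "\<exists>I. I \<subseteq> B \<and> independent M I \<and> B \<subseteq> closure_of_set M I" using assms
  proof (induction B rule: finite_induct)
    case empty
    then show ?case by (auto simp: independent_def)
  next
    case (insert x B)
    then obtain I where I: "I \<subseteq> B" "independent M I" "B \<subseteq> closure_of_set M I" by blast
    show ?case
    proof (cases "x \<in> closure_of_set M I")
      case True
      then show ?thesis using I by (intro exI[of _ I]) auto
    next
      case False
      have "closure_of_set M I \<subseteq> closure_of_set M (insert x I)" by (intro closure_mono) auto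
      moreover have "insert x I \<subseteq> closure_of_set M (insert x I)" by (rule closure_extensive)
      ultimately show ?thesis using I independent_insert[OF I(2) _ False] insert.prems
        by (intro exI[of _ "insert x I"]) auto
    qed
  qed
  then show thesis using that by blast
qed

lemma matroid_rank_empty: "matroid_rank M {} = 0"
  using matroid_rank_eq_card[of "{}" "{}"] by (simp add: independent_def)

lemma matroid_rank_insert:
  assumes "B \<subseteq> ground M" "e \<in> ground M"
  shows "matroid_rank M (insert e B) = matroid_rank M B + (if e \<in> closure_of_set M B then 0 else 1)"
proof -
  obtain I where I: "I \<subseteq> B" "independent M I" "B \<subseteq> closure_of_set M I"
    using obtain_basis assms(1) by blast
  have rB: "matroid_rank M B = card I" using matroid_rank_eq_card assms I by blast
  have cl: "closure_of_set M B = closure_of_set M I"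
    using closure_mono[OF I(1)] closure_least[OF I(3)] by (rule subset_antisym[rotated])
  show ?thesis
  proof (cases "e \<in> closure_of_set M B")
    case True
    then show ?thesis using matroid_rank_eq_card[of "insert e B" I] I assms rB cl by auto
  next
    case False
    then have ind: "independent M (insert e I)" using independent_insert I assms cl by auto
    have "closure_of_set M I \<subseteq> closure_of_set M (insert e I)" by (intro closure_mono) auto
    moreover have "insert e I \<subseteq> closure_of_set M (insert e I)" by (rule closure_extensive)
    ultimately have "matroid_rank M (insert e B) = card (insert e I)"
      using matroid_rank_eq_card[OF _ _ ind, of "insert e B"] I assms by auto
    moreover have "finite I"
      using I(1) assms(1) finite_ground by (meson finite_subset)
    moreover have "e \<notin> I" using False cl closure_extensive[of I M] by auto
    ultimately show ?thesis using False rB by simp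
  qed
qed

lemma matroid_rank_closure:
  assumes "B \<subseteq> ground M" "C \<subseteq> ground M" "B \<subseteq> C" "C \<subseteq> closure_of_set M B"
  shows "matroid_rank M C = matroid_rank M B"
proof -
  obtain I where I: "I \<subseteq> B" "independent M I" "B \<subseteq> closure_of_set M I"
    using obtain_basis assms(1) by blast
  then have "C \<subseteq> closure_of_set M I" using assms(4) closure_least by blast
  then show ?thesis using matroid_rank_eq_card[of C I] matroid_rank_eq_card[of B I] I assms by auto
qed

text \<open>Pairing each \<open>B\<close> avoiding \<open>e\<close> with \<open>insert e B\<close>
  leaves only the rank increase, which is one if \<open>e\<close> is outside the closure of
  \<open>B\<close> and zero otherwise.\<close>

lemma crapo_beta_eq:
  assumes "e \<in> ground M"
  shows "crapo_beta M = (- 1) ^ Suc (matroid_rank M (ground M)) *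
    (\<Sum>B | B \<subseteq> ground M \<and> e \<notin> closure_of_set M B. (- 1) ^ card B)"
proof -
  let ?E = "ground M"
  let ?g = "\<lambda>B. (- 1) ^ card B * int (matroid_rank M B)"
  have fin: "finite (Pow (?E - {e}))" using finite_ground by simp
  have split: "Pow ?E = Pow (?E - {e}) \<union> insert e ` Pow (?E - {e})"
    using assms Pow_insert[of e "?E - {e}"] by (simp add: insert_absorb)
  have inj: "inj_on (insert e) (Pow (?E - {e}))" by (auto simp: inj_on_def)
  have "sum ?g (Pow ?E) = sum ?g (Pow (?E - {e})) + sum ?g (insert e ` Pow (?E - {e}))"
    unfolding split by (rule sum.union_disjoint) (use fin in auto)
  also have "sum ?g (insert e ` Pow (?E - {e})) = (\<Sum>B\<in>Pow (?E - {e}). ?g (insert e B))"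
    by (simp add: sum.reindex[OF inj] o_def)
  also have "sum ?g (Pow (?E - {e})) + \<dots> = (\<Sum>B\<in>Pow (?E - {e}). ?g B + ?g (insert e B))"
    by (simp add: sum.distrib)
  also have "\<dots> = (\<Sum>B\<in>Pow (?E - {e}). if e \<in> closure_of_set M B then 0 else - ((- 1) ^ card B))"
  proof (rule sum.cong[OF refl])
    fix B assume B: "B \<in> Pow (?E - {e})"
    then have "finite B" "e \<notin> B" using finite_ground finite_subset[of B ?E] by auto
    then have "card (insert e B) = Suc (card B)" by simp
    moreover have "B \<subseteq> ?E" using B by blast
    ultimately show "?g B + ?g (insert e B) = (if e \<in> closure_of_set M B then 0 else - ((- 1) ^ card B))"
      using matroid_rank_insert[of B e] assms by (auto simp: algebra_simps)
  qed
  also have "\<dots> = (\<Sum>B \<in> {B \<in> Pow (?E - {e}). e \<notin> closure_of_set M B}. - ((- 1) ^ card B))"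
    using fin by (subst sum.inter_filter) (auto intro!: sum.cong)
  \<comment> \<open>A set whose closure misses \<open>e\<close> does not contain \<open>e\<close>,
    so the restriction to subsets of \<open>?E - {e}\<close> can be lifted.\<close>
  also have "{B \<in> Pow (?E - {e}). e \<notin> closure_of_set M B} =
      {B. B \<subseteq> ?E \<and> e \<notin> closure_of_set M B}"
    using closure_extensive[of _ M] by auto
  finally show ?thesis unfolding crapo_beta_def by (simp add: sum_negf)
qed

end

section \<open>Euler characteristics of cones\<close>

lemma uminus_uminus_sign [simp]: "- (- s) = (s :: sign)"
  by (cases s) auto

lemma uminus_sign_eq_Zero [simp]: "- s = Zero \<longleftrightarrow> s = Zero"
  by (cases s) auto

lemma Zero_eq_uminus_sign [simp]: "Zero = - s \<longleftrightarrow> s = Zero"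
  by (cases s) auto

lemma uminus_sign_eq_iff [simp]: "- s = t \<longleftrightarrow> s = - (t :: sign)"
  by (cases s; cases t) auto

lemma sign_eq_uminus_iff [simp]: "s = - s \<longleftrightarrow> s = Zero"
  by (cases s) auto

lemma sign_trichotomy: "t \<noteq> Zero \<Longrightarrow> s = t \<or> s = - t \<or> s = (Zero :: sign)"
  by (cases s; cases t) auto

lemma sign_vector_le_iff: "F \<le> G \<longleftrightarrow> (\<forall>e. F e = Zero \<or> F e = (G e :: sign))"
  by (simp add: le_fun_def less_eq_sign_def)

lemma compose_apply: "compose X Y e = (if X e \<noteq> Zero then X e else Y e)"
  by (simp add: compose_def)

lemma sum_Pow_alternating:
  assumes "finite S"
  shows "(\<Sum>B\<in>Pow S. (- 1) ^ card B) = (if S = {} then 1 else (0 :: int))"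
  using assms
proof (induction S rule: finite_induct)
  case (insert x S)
  have inj: "inj_on (insert x) (Pow S)" using insert.hyps by (auto simp: inj_on_def)
  have "(\<Sum>B\<in>Pow (insert x S). (- 1) ^ card B) =
      (\<Sum>B\<in>Pow S. (- 1) ^ card B) + (\<Sum>B\<in>insert x ` Pow S. (- 1 :: int) ^ card B)"
    unfolding Pow_insert using insert.hyps by (intro sum.union_disjoint) auto
  also have "(\<Sum>B\<in>insert x ` Pow S. (- 1 :: int) ^ card B) = (\<Sum>B\<in>Pow S. (- 1) ^ card (insert x B))"
    by (simp add: sum.reindex[OF inj] o_def)
  also have "\<dots> = (\<Sum>B\<in>Pow S. - ((- 1) ^ card B))"
  proof (rule sum.cong[OF refl])
    fix B assume "B \<in> Pow S"
    then have "finite B" "x \<notin> B" using insert.hyps finite_subset by auto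
    then show "(- 1 :: int) ^ card (insert x B) = - ((- 1) ^ card B)" by simp
  qed
  finally show ?case by (simp add: sum_negf)
qed simp

lemma sum_interval_alternating:
  assumes "finite S" "A \<subseteq> S"
  shows "(\<Sum>B | A \<subseteq> B \<and> B \<subseteq> S. (- 1) ^ card (B - A)) = (if S = A then 1 else (0 :: int))"
proof -
  have "(\<Sum>B | A \<subseteq> B \<and> B \<subseteq> S. (- 1) ^ card (B - A)) = (\<Sum>C\<in>Pow (S - A). (- 1 :: int) ^ card C)"
    by (rule sum.reindex_bij_witness[of _ "\<lambda>C. C \<union> A" "\<lambda>B. B - A"])
      (use assms in \<open>auto intro!: arg_cong[of _ _ card]\<close>)
  also have "\<dots> = (if S = A then 1 else 0)"
    using sum_Pow_alternating[of "S - A"] assms by auto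
  finally show ?thesis .
qed

lemma ground_Mat [simp]: "ground (Mat E L) = E"
  by (simp add: Mat_def)

section \<open>Covectors and the closure operator given by their zero sets\<close>

context oriented_matroid
begin

abbreviation z :: "'e sign_vector \<Rightarrow> 'e set" where
  "z \<equiv> zero_set E"

abbreviation rk :: "'e set \<Rightarrow> nat" where
  "rk \<equiv> matroid_rank (Mat E L)"

abbreviation cl :: "'e set \<Rightarrow> 'e set" where
  "cl \<equiv> closure_of_set (Mat E L)"

text \<open>The rank of \<open>z F\<close> is the codimension-like parameter of the face
  \<open>F\<close>, so a sum of \<open>sg (z F)\<close> over faces is, up to a global sign, an Euler
  characteristic.\<close>

definition sg :: "'e set \<Rightarrow> int" where
  "sg B = (- 1) ^ rk B"

lemma outside_ground: "X \<in> L \<Longrightarrow> e \<notin> E \<Longrightarrow> X e = Zero"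
  using covectors by (auto simp: sign_vectors_def)

lemma zero_set_iff [simp]: "e \<in> z X \<longleftrightarrow> e \<in> E \<and> X e = Zero"
  by (simp add: zero_set_def)

lemma zero_set_subset: "z X \<subseteq> E"
  by auto

lemma finite_zero_set [simp]: "finite (z X)"
  using finite_ground zero_set_subset finite_subset by blast

lemma covector_eqI:
  assumes "X \<in> L" "Y \<in> L" "\<And>e. e \<in> E \<Longrightarrow> X e = Y e"
  shows "X = Y"
  using assms outside_ground by (metis ext)

lemma finite_covectors: "finite L"
proof -
  have "finite {X :: 'e \<Rightarrow> sign. \<forall>e. (e \<in> E \<longrightarrow> X e \<in> {Zero, Pos, Neg}) \<and> (e \<notin> E \<longrightarrow> X e = Zero)}"
    using finite_ground by (intro finite_set_of_finite_funs) auto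
  moreover have "L \<subseteq> {X. \<forall>e. (e \<in> E \<longrightarrow> X e \<in> {Zero, Pos, Neg}) \<and> (e \<notin> E \<longrightarrow> X e = Zero)}"
    using outside_ground sign.exhaust by blast
  ultimately show ?thesis using finite_subset by blast
qed

lemma flats_Mat: "flats (Mat E L) = z ` L"
  by (simp add: Mat_def)

lemma mem_closure_iff: "e \<in> cl B \<longleftrightarrow> (\<forall>F\<in>L. B \<subseteq> z F \<longrightarrow> e \<in> z F)"
  by (auto simp: closure_of_set_def flats_Mat)

lemma not_mem_closureE:
  assumes "e \<notin> cl B" "e \<in> E"
  obtains X where "X \<in> L" "\<forall>b\<in>B. X b = Zero" "X e \<noteq> Zero"
proof -
  obtain F where F: "F \<in> L" "B \<subseteq> z F" "F e \<noteq> Zero"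
    using assms by (auto simp: mem_closure_iff)
  then have "\<forall>b\<in>B. F b = Zero" by auto
  then show thesis using that F by blast
qed

lemma mem_closure_vanishes:
  assumes "e \<in> cl B" "F \<in> L" "B \<subseteq> E" "\<forall>b\<in>B. F b = Zero"
  shows "F e = Zero"
proof -
  have "B \<subseteq> z F" using assms by auto
  then show ?thesis using assms mem_closure_iff by auto
qed

text \<open>If exchange failed, some \<open>X\<close> would vanish on \<open>insert f B\<close> but
  not at \<open>e\<close>, and some \<open>Y\<close> on \<open>B\<close> but not at
  \<open>f\<close>. Eliminating \<open>e\<close> between them gives a covector vanishing on
  \<open>insert e B\<close> but not at \<open>f\<close>.\<close>

lemma exchange_property:
  assumes "B \<subseteq> E" "e \<in> E" "f \<in> E" "f \<in> cl (insert e B)" "f \<notin> cl B"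
  shows "e \<in> cl (insert f B)"
proof (rule ccontr)
  assume "e \<notin> cl (insert f B)"
  then obtain X where X: "X \<in> L" "\<forall>b\<in>insert f B. X b = Zero" "X e \<noteq> Zero"
    using assms not_mem_closureE by blast
  obtain Y where Y: "Y \<in> L" "\<forall>b\<in>B. Y b = Zero" "Y f \<noteq> Zero"
    using assms not_mem_closureE by blast
  \<comment> \<open>Otherwise \<open>Y\<close> would vanish on \<open>insert e B\<close> and hence
    at \<open>f\<close>.\<close>
  have "Y e \<noteq> Zero" using mem_closure_vanishes[OF assms(4) Y(1)] assms Y by auto
  define X' where "X' = (if X e = - Y e then X else - X)"
  have X': "X' \<in> L" "\<forall>b\<in>insert f B. X' b = Zero" "X' e = - Y e"
    using X symmetry sign_trichotomy[of "Y e" "X e"] \<open>Y e \<noteq> Zero\<close>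
    by (auto simp: X'_def)
  then have "e \<in> Sep X' Y" using \<open>Y e \<noteq> Zero\<close> by (simp add: Sep_def)
  then obtain Z where Z: "Z \<in> L" "Z e = Zero" "\<forall>g\<in>E - Sep X' Y. Z g = compose X' Y g"
    using elimination[OF X'(1) Y(1)] by blast
  have "\<forall>b\<in>insert f B. b \<in> E - Sep X' Y" using X' assms by (auto simp: Sep_def)
  then have "\<forall>b\<in>insert e B. Z b = Zero" "Z f \<noteq> Zero"
    using Z X' Y by (auto simp: compose_apply)
  then show False using mem_closure_vanishes[OF assms(4) Z(1)] assms by auto
qed

sublocale matroid: exchange_flats "Mat E L"
  by standard (use finite_ground exchange_property in simp_all)

lemma sg_insert:
  assumes "B \<subseteq> E" "e \<in> E" "e \<notin> cl B"
  shows "sg (insert e B) = - sg B"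
  using matroid.matroid_rank_insert[of B e] assms by (simp add: sg_def)

lemma sg_empty: "sg {} = 1"
  by (simp add: sg_def matroid.matroid_rank_empty)

lemma sg_square [simp]: "sg B * sg B = 1"
  by (simp add: sg_def flip: power_mult_distrib)

text \<open>The relatively open cone cut out of the subspace where \<open>A\<close> vanishes by
  strict inequalities on \<open>I\<close>. Only the values of \<open>X\<close> on \<open>I\<close>
  matter; the hypothesis \<open>X \<in> cone A I X\<close> below says that the cone is
  nonempty.\<close>

definition cone :: "'e set \<Rightarrow> 'e set \<Rightarrow> 'e sign_vector \<Rightarrow> 'e sign_vector set" where
  "cone A I X = {F \<in> L. (\<forall>a\<in>A. F a = Zero) \<and> (\<forall>i\<in>I. F i = X i)}"

lemma cone_cong: "(\<And>i. i \<in> I \<Longrightarrow> X i = Y i) \<Longrightarrow> cone A I X = cone A I Y"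
  by (auto simp: cone_def)

lemma finite_cone [simp]: "finite (cone A I X)"
  using finite_covectors by (simp add: cone_def)

lemma compose_in_cone:
  assumes "X \<in> cone A I X" "\<forall>i\<in>I. X i \<noteq> Zero" "G \<in> L" "\<forall>a\<in>A. G a = Zero"
  shows "compose X G \<in> cone A I X"
  using assms composition by (auto simp: cone_def compose_apply)

text \<open>
  Cutting an open cone by a hyperplane \<open>j\<close> that meets it leaves two cones of the same
  dimension and one of dimension one less, so the alternating sum does not change.
\<close>

lemma euler_cone:
  assumes "A \<subseteq> E" "I \<subseteq> E" "X \<in> cone A I X" "\<forall>i\<in>I. X i \<noteq> Zero"
  shows "(\<Sum>F\<in>cone A I X. sg (z F)) = sg A"
  using assms
proof (induction "card (E - I - cl A)" arbitrary: A I X rule: less_induct)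
  case less
  note X = less.prems(3,4)
  show ?case
  proof (cases "E \<subseteq> I \<union> cl A")
    case True
    \<comment> \<open>No hyperplane is left to cut with: entries on \<open>I\<close> are prescribed
      and entries on \<open>cl A\<close> vanish, so the cone is the single point
      \<open>X\<close>.\<close>
    have vanish: "F e = Zero" if "F \<in> cone A I X" "e \<in> cl A" for F e
      using that mem_closure_vanishes[of e A F] less.prems(1) by (auto simp: cone_def)
    have "F = X" if F: "F \<in> cone A I X" for F
    proof (rule covector_eqI)
      show "F e = X e" if "e \<in> E" for e
        using that True F vanish[OF F, of e] vanish[OF X(1), of e] by (auto simp: cone_def)
    qed (use F X in \<open>auto simp: cone_def\<close>)
    then have "cone A I X = {X}" using X by blast
    moreover have "rk (z X) = rk A"
    proof (rule matroid.matroid_rank_closure)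
      show "A \<subseteq> z X" using X less.prems(1) by (auto simp: cone_def)
      show "z X \<subseteq> cl A" using X True by auto
    qed (use less.prems zero_set_subset in simp_all)
    ultimately show ?thesis by (simp add: sg_def)
  next
    case False
    then obtain j where j: "j \<in> E" "j \<notin> I" "j \<notin> cl A" by blast
    have fin: "finite (E - I - cl A)" using finite_ground by simp
    have smaller1: "card (E - insert j I - cl A) < card (E - I - cl A)"
      using j fin by (intro psubset_card_mono) auto
    have "cl A \<subseteq> cl (insert j A)" "j \<in> cl (insert j A)"
      using closure_mono[of A "insert j A"] closure_extensive[of "insert j A" "Mat E L"] by auto
    then have smaller0: "card (E - I - cl (insert j A)) < card (E - I - cl A)"
      using j fin by (intro psubset_card_mono) auto
    obtain G where G: "G \<in> L" "\<forall>a\<in>A. G a = Zero" "G j \<noteq> Zero"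
      using not_mem_closureE j by blast
    \<comment> \<open>A perturbation of \<open>X\<close> that stays in the cone but leaves the
      hyperplane \<open>j\<close>.\<close>
    define Y where "Y = compose X G"
    have Y: "Y \<in> cone A I X" "Y j \<noteq> Zero"
      using compose_in_cone[OF X G(1,2)] G by (auto simp: Y_def compose_apply)
    have YL: "Y \<in> L" "\<forall>a\<in>A. Y a = Zero" "\<forall>i\<in>I. Y i = X i" using Y by (auto simp: cone_def)
    define C where "C s = {F \<in> cone A I X. F j = s}" for s
    have "cone A I X = C (Y j) \<union> C (- Y j) \<union> C Zero"
      using sign_trichotomy[OF Y(2)] by (auto simp: C_def)
    moreover have "finite (C s)" for s by (simp add: C_def)
    moreover have "C (Y j) \<inter> C (- Y j) = {}" "(C (Y j) \<union> C (- Y j)) \<inter> C Zero = {}"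
      using Y(2) by (auto simp: C_def)
    ultimately have total: "(\<Sum>F\<in>cone A I X. sg (z F)) = (\<Sum>F\<in>C (Y j). sg (z F)) +
        (\<Sum>F\<in>C (- Y j). sg (z F)) + (\<Sum>F\<in>C Zero. sg (z F))"
      by (simp add: sum.union_disjoint)
    have side: "(\<Sum>F\<in>C (Y' j). sg (z F)) = sg A" if Y': "Y' \<in> cone A I X" "Y' j \<noteq> Zero" for Y'
    proof -
      have "C (Y' j) = cone A (insert j I) Y'" using Y' by (auto simp: C_def cone_def)
      moreover have "(\<Sum>F\<in>cone A (insert j I) Y'. sg (z F)) = sg A"
        using less.hyps[OF smaller1, of Y'] less.prems j Y' by (auto simp: cone_def)
      ultimately show ?thesis by simp
    qed
    show ?thesis
    proof (cases "\<exists>Y'\<in>cone A I X. Y' j = - Y j")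
      case True
      then obtain Y' where Y': "Y' \<in> cone A I X" "Y' j = - Y j" by blast
      then have Y'L: "Y' \<in> L" "\<forall>a\<in>A. Y' a = Zero" "\<forall>i\<in>I. Y' i = X i" by (auto simp: cone_def)
      \<comment> \<open>Elimination between points on both sides of \<open>j\<close> produces a
        point of the cone on the hyperplane, so the middle piece is nonempty as well.\<close>
      have "j \<in> Sep Y Y'" using Y Y' by (simp add: Sep_def)
      then obtain Z where Z: "Z \<in> L" "Z j = Zero" "\<forall>g\<in>E - Sep Y Y'. Z g = compose Y Y' g"
        using elimination[OF YL(1) Y'L(1)] by blast
      have "\<forall>a\<in>A \<union> I. a \<in> E - Sep Y Y'"
        using YL Y'L X(2) less.prems(1,2) by (auto simp: Sep_def)
      then have Z': "Z \<in> cone (insert j A) I Z" "\<forall>i\<in>I. Z i = X i"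
        using Z YL Y'L by (auto simp: cone_def compose_apply)
      have "C Zero = cone (insert j A) I X" by (auto simp: C_def cone_def)
      also have "\<dots> = cone (insert j A) I Z" using Z' by (intro cone_cong) simp
      finally have "(\<Sum>F\<in>C Zero. sg (z F)) = sg (insert j A)"
        using less.hyps[OF smaller0, of Z] less.prems j Z' by auto
      \<comment> \<open>The two sides contribute \<open>sg A\<close> each and the wall contributes
        \<open>- sg A\<close>.\<close>
      then show ?thesis using total side[OF Y] side[OF Y'(1)] Y' Y sg_insert less.prems(1) j by simp
    next
      case False
      then have "C (- Y j) = {}" by (auto simp: C_def)
      \<comment> \<open>A point of the cone on the hyperplane could be pushed to the missing side by
        composing it with \<open>- Y\<close>.\<close>
      moreover have "C Zero = {}"
      proof (rule ccontr)
        assume "C Zero \<noteq> {}"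
        then obtain F where F: "F \<in> cone A I X" "F j = Zero" by (auto simp: C_def)
        have "compose F (- Y) \<in> cone A I X"
          using F YL X(2) composition symmetry by (auto simp: cone_def compose_apply)
        moreover have "compose F (- Y) j = - Y j" using F by (simp add: compose_apply)
        ultimately show False using False by blast
      qed
      ultimately show ?thesis using total side[OF Y] by simp
    qed
  qed
qed

text \<open>Strict inequalities on \<open>I\<close> and weak ones on \<open>J\<close>, all in the
  direction of \<open>D\<close>.\<close>

definition half_open_cone :: "'e set \<Rightarrow> 'e set \<Rightarrow> 'e set \<Rightarrow> 'e sign_vector \<Rightarrow> 'e sign_vector set" where
  "half_open_cone A I J D = {F \<in> cone A I D. \<forall>j\<in>J. F j = Zero \<or> F j = D j}"

text \<open>The weak inequality at \<open>j\<close> is the complement of the strict inequality in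
  the opposite direction.\<close>

lemma half_open_cone_insert:
  assumes "j \<notin> I" "j \<notin> J" "D j \<noteq> Zero"
  shows "half_open_cone A I (insert j J) D =
    half_open_cone A I J D - half_open_cone A (insert j I) J (D(j := - D j))"
    and "half_open_cone A (insert j I) J (D(j := - D j)) \<subseteq> half_open_cone A I J D"
proof -
  have "(F j = Zero \<or> F j = D j) = (F j \<noteq> - D j)" for F :: "'e sign_vector"
    using sign_trichotomy[OF assms(3), of "F j"] assms(3) by auto
  moreover have "(\<forall>i\<in>I. F i = (D(j := - D j)) i) = (\<forall>i\<in>I. F i = D i)"
    "(\<forall>i\<in>J. F i = Zero \<or> F i = (D(j := - D j)) i) = (\<forall>i\<in>J. F i = Zero \<or> F i = D i)"
    for F :: "'e sign_vector"
    using assms by (auto simp: fun_upd_def)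
  ultimately show "half_open_cone A I (insert j J) D =
    half_open_cone A I J D - half_open_cone A (insert j I) J (D(j := - D j))"
    "half_open_cone A (insert j I) J (D(j := - D j)) \<subseteq> half_open_cone A I J D"
    unfolding half_open_cone_def cone_def by auto
qed

lemma finite_half_open_cone [simp]: "finite (half_open_cone A I J D)"
  by (simp add: half_open_cone_def)

text \<open>Imposing the weak inequalities one at a time removes cones that are strict and opposite
  to \<open>D\<close> on some elements of \<open>J\<close>. The point \<open>- W\<close> has the
  signs of \<open>D\<close> on \<open>I\<close> and the opposite ones on \<open>J\<close>, so all
  open cones involved are nonempty and contribute \<open>sg A\<close>; as \<open>J\<close> is
  nonempty, these contributions cancel.\<close>

lemma euler_half_open_cone:
  assumes "A \<subseteq> E" "I \<subseteq> E" "J \<subseteq> E" "J \<noteq> {}" "I \<inter> J = {}" "\<forall>i\<in>I \<union> J. D i \<noteq> Zero"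
    and "W \<in> L" "\<forall>a\<in>A. W a = Zero" "\<forall>i\<in>I. W i = - D i" "\<forall>j\<in>J. W j = D j"
  shows "(\<Sum>F\<in>half_open_cone A I J D. sg (z F)) = 0"
proof -
  have "finite J" using assms(3) finite_ground finite_subset by blast
  then show ?thesis using assms(4,2,3,5-)
  proof (induction J arbitrary: I D rule: finite_ne_induct)
    case (singleton j)
    have W: "- W \<in> cone A I (- W)" "- W \<in> cone A (insert j I) (- W)"
      using singleton.prems symmetry by (auto simp: cone_def)
    have "half_open_cone A I {} D = cone A I (- W)"
      "half_open_cone A (insert j I) {} (D(j := - D j)) = cone A (insert j I) (- W)"
      using singleton.prems by (auto simp: half_open_cone_def intro!: cone_cong)
    moreover have "(\<Sum>F\<in>cone A I (- W). sg (z F)) = sg A"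
      "(\<Sum>F\<in>cone A (insert j I) (- W). sg (z F)) = sg A"
      using singleton.prems assms(1) W by (intro euler_cone; force)+
    ultimately show ?case
      using half_open_cone_insert[of j I "{}" D A] singleton.prems
      by (simp add: sum_diff)
  next
    case (insert j J)
    have "(\<Sum>F\<in>half_open_cone A I J D. sg (z F)) = 0"
      using insert.prems by (intro insert.IH) auto
    moreover have "(\<Sum>F\<in>half_open_cone A (insert j I) J (D(j := - D j)). sg (z F)) = 0"
      using insert.prems insert.hyps by (intro insert.IH) auto
    ultimately show ?case
      using half_open_cone_insert[of j I J D A] insert.prems insert.hyps
      by (simp add: sum_diff)
  qed
qed

end

section \<open>Counting covectors and topes\<close>

context oriented_matroid
begin

lemma compose_ge: "X \<le> compose X Y"
  by (simp add: sign_vector_le_iff compose_apply)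

lemma compose_le:
  assumes "X \<le> Z" "Y \<le> Z"
  shows "compose X Y \<le> Z"
  using assms by (auto simp: sign_vector_le_iff compose_apply)

lemma zero_set_antimono: "X \<le> Y \<Longrightarrow> z Y \<subseteq> z X"
  by (force simp: sign_vector_le_iff)

lemma sum_zero_set_ge:
  assumes "A \<subseteq> E"
  shows "(\<Sum>F | F \<in> L \<and> A \<subseteq> z F. sg (z F)) = sg A"
proof -
  have "{F. F \<in> L \<and> A \<subseteq> z F} = cone A {} (\<lambda>_. Zero)" using assms by (auto simp: cone_def)
  then show ?thesis using euler_cone[of A "{}" "\<lambda>_. Zero"] assms zero by (simp add: cone_def)
qed

text \<open>
  The right hand side depends on the underlying matroid only, and hence so does the number of
  covectors with a given zero set.
\<close>

lemma card_zero_set_eq: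
  assumes "A \<subseteq> E"
  shows "int (card {F \<in> L. z F = A}) =
    sg A * (\<Sum>B | A \<subseteq> B \<and> B \<subseteq> E. (- 1) ^ card (B - A) * sg B)"
proof -
  let ?I = "{B. A \<subseteq> B \<and> B \<subseteq> E}"
  have finI: "finite ?I" using finite_ground by simp
  \<comment> \<open>Each \<open>sg B\<close> is expanded over the covectors vanishing on
    \<open>B\<close>. After the sums are swapped, the alternating sum over the interval from
    \<open>A\<close> to \<open>z F\<close> keeps only \<open>z F = A\<close>.\<close>
  have "(\<Sum>B\<in>?I. (- 1) ^ card (B - A) * sg B) =
      (\<Sum>B\<in>?I. \<Sum>F\<in>L. if B \<subseteq> z F then (- 1) ^ card (B - A) * sg (z F) else 0)"
  proof (rule sum.cong[OF refl])
    fix B assume "B \<in> ?I"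
    then show "(- 1) ^ card (B - A) * sg B =
      (\<Sum>F\<in>L. if B \<subseteq> z F then (- 1) ^ card (B - A) * sg (z F) else 0)"
      using finite_covectors by (simp add: sum.inter_filter[symmetric] sum_zero_set_ge flip: sum_distrib_left)
  qed
  also have "\<dots> = (\<Sum>F\<in>L. \<Sum>B\<in>?I. if B \<subseteq> z F then (- 1) ^ card (B - A) * sg (z F) else 0)"
    by (rule sum.swap)
  also have "\<dots> = (\<Sum>F\<in>L. if z F = A then sg A else 0)"
  proof (rule sum.cong[OF refl])
    fix F assume "F \<in> L"
    have "(\<Sum>B\<in>?I. if B \<subseteq> z F then (- 1) ^ card (B - A) * sg (z F) else 0) =
        (\<Sum>B\<in>{B \<in> ?I. B \<subseteq> z F}. (- 1) ^ card (B - A)) * sg (z F)"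
      using finI by (simp add: sum.inter_filter[symmetric] sum_distrib_right)
    also have "{B \<in> ?I. B \<subseteq> z F} = {B. A \<subseteq> B \<and> B \<subseteq> z F}" using zero_set_subset by blast
    also have "(\<Sum>B\<in>\<dots>. (- 1) ^ card (B - A)) = (if z F = A then 1 else (0 :: int))"
    proof (cases "A \<subseteq> z F")
      case True
      then show ?thesis by (simp add: sum_interval_alternating)
    next
      case False
      then have "{B. A \<subseteq> B \<and> B \<subseteq> z F} = {}" "z F \<noteq> A" by blast+
      then show ?thesis by (simp only: sum.empty if_False)
    qed
    finally show "(\<Sum>B\<in>?I. if B \<subseteq> z F then (- 1) ^ card (B - A) * sg (z F) else 0) =
      (if z F = A then sg A else 0)" by auto
  qed
  also have "\<dots> = int (card {F \<in> L. z F = A}) * sg A"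
    using finite_covectors by (simp add: sum.inter_filter[symmetric])
  finally show ?thesis by (simp add: mult.commute mult.left_commute)
qed

text \<open>The faces of \<open>F\<close> with zero entry at \<open>e\<close> are closed under
  composition, so a maximal one is the greatest.\<close>

lemma exists_greatest_face:
  "\<exists>H. H \<in> L \<and> H \<le> F \<and> H e = Zero \<and> (\<forall>G\<in>L. G \<le> F \<longrightarrow> G e = Zero \<longrightarrow> G \<le> H)"
proof -
  let ?K = "{G \<in> L. G \<le> F \<and> G e = Zero}"
  have fin: "finite ?K" using finite_covectors by simp
  have "(\<lambda>_. Zero) \<in> ?K" using zero by (simp add: sign_vector_le_iff)
  then have ne: "?K \<noteq> {}" by blast
  obtain H where H: "H \<in> ?K" "\<forall>G\<in>?K. H \<le> G \<longrightarrow> H = G"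
    using finite_has_maximal[OF fin ne] by (rule bexE)
  have "G \<le> H" if "G \<in> ?K" for G
  proof -
    have "compose H G \<in> ?K"
      using that H(1) composition compose_le by (auto simp: compose_apply)
    then have "H = compose H G" using H(2) compose_ge[of H G] by blast
    moreover have "G \<le> F" "H \<le> F" using that H by auto
    ultimately show "G \<le> H"
      unfolding sign_vector_le_iff compose_def fun_eq_iff by metis
  qed
  then show ?thesis using H(1) by blast
qed

definition face :: "'e \<Rightarrow> 'e sign_vector \<Rightarrow> 'e sign_vector" where
  "face e F = (SOME H. H \<in> L \<and> H \<le> F \<and> H e = Zero \<and>
    (\<forall>G\<in>L. G \<le> F \<longrightarrow> G e = Zero \<longrightarrow> G \<le> H))"

lemma face_properties:
  "face e F \<in> L \<and> face e F \<le> F \<and> face e F e = Zero \<and>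
    (\<forall>G\<in>L. G \<le> F \<longrightarrow> G e = Zero \<longrightarrow> G \<le> face e F)"
  using someI_ex[OF exists_greatest_face] unfolding face_def .

lemma face_in: "face e F \<in> L"
  using face_properties by blast

lemma face_le: "face e F \<le> F"
  using face_properties by blast

lemma face_apply: "face e F e = Zero"
  using face_properties by blast

lemma face_greatest: "G \<in> L \<Longrightarrow> G \<le> F \<Longrightarrow> G e = Zero \<Longrightarrow> G \<le> face e F"
  using face_properties by blast

text \<open>The faces summed over form the interval from \<open>F0\<close> to
  \<open>H = face e F\<close>. If it is more than a point, it is a half-open cone: strict on the
  support of \<open>F0\<close>, weak on the rest of the support of \<open>H\<close>. Its sum then
  vanishes.\<close>

lemma sum_faces_in_hyperplane:
  assumes "F0 \<in> L" "F \<in> L" "F0 \<le> F" "F0 e = Zero"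
  shows "(\<Sum>G | G \<in> L \<and> F0 \<le> G \<and> G \<le> F \<and> G e = Zero. sg (z G)) =
    (if face e F = F0 then sg (z F0) else 0)"
proof -
  define H where "H = face e F"
  have H: "H \<in> L" "H \<le> F" "H e = Zero" and F0H: "F0 \<le> H"
    using face_in face_le face_apply face_greatest assms by (auto simp: H_def)
  have eq: "{G. G \<in> L \<and> F0 \<le> G \<and> G \<le> F \<and> G e = Zero} = {G \<in> L. F0 \<le> G \<and> G \<le> H}"
  proof (intro Set.set_eqI iffI)
    fix G assume "G \<in> {G \<in> L. F0 \<le> G \<and> G \<le> H}"
    moreover then have "G e = Zero" using H by (auto simp: sign_vector_le_iff)
    ultimately show "G \<in> {G. G \<in> L \<and> F0 \<le> G \<and> G \<le> F \<and> G e = Zero}"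
      using H by auto
  qed (auto simp: H_def face_greatest)
  show ?thesis
  proof (cases "H = F0")
    case True
    then have "{G \<in> L. F0 \<le> G \<and> G \<le> H} = {F0}" using assms by auto
    then show ?thesis using True eq by (simp add: H_def)
  next
    case False
    let ?I = "{i \<in> E. F0 i \<noteq> Zero}" and ?J = "{i \<in> E. F0 i = Zero \<and> H i \<noteq> Zero}"
    have "{G \<in> L. F0 \<le> G \<and> G \<le> H} = half_open_cone (z H) ?I ?J H"
    proof (intro Set.set_eqI iffI)
      fix G assume "G \<in> {G \<in> L. F0 \<le> G \<and> G \<le> H}"
      then have G: "G \<in> L" "\<And>i. F0 i = Zero \<or> F0 i = G i" "\<And>i. G i = Zero \<or> G i = H i"
        by (auto simp: sign_vector_le_iff)
      have "G i = Zero" if "i \<in> z H" for i using G(3)[of i] that by auto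
      moreover have "G i = H i" if "i \<in> ?I" for i using G(2,3)[of i] that by auto
      ultimately show "G \<in> half_open_cone (z H) ?I ?J H"
        using G by (simp add: half_open_cone_def cone_def)
    next
      fix G assume G: "G \<in> half_open_cone (z H) ?I ?J H"
      have "G i = Zero \<or> G i = H i" "F0 i = Zero \<or> F0 i = G i" for i
        using G F0H outside_ground[of G i] outside_ground[of F0 i] assms(1)
        unfolding half_open_cone_def cone_def sign_vector_le_iff by (cases "i \<in> E"; force)+
      then show "G \<in> {G \<in> L. F0 \<le> G \<and> G \<le> H}"
        using G by (simp add: sign_vector_le_iff half_open_cone_def cone_def)
    qed
    moreover have "(\<Sum>G\<in>half_open_cone (z H) ?I ?J H. sg (z G)) = 0"
    proof (rule euler_half_open_cone)
      show "?J \<noteq> {}"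
      proof
        assume "?J = {}"
        then have "H i = F0 i" if "i \<in> E" for i using F0H that by (force simp: sign_vector_le_iff)
        then show False using False H assms covector_eqI by blast
      qed
      \<comment> \<open>The witness \<open>W\<close>: reversing \<open>H\<close> exactly on the
        support of \<open>F0\<close> makes it opposite on \<open>?I\<close> and leaves it unchanged
        on \<open>?J\<close>.\<close>
      show "compose (- F0) H \<in> L" using H assms composition symmetry by blast
      show "\<forall>i\<in>?I \<union> ?J. H i \<noteq> Zero" "\<forall>a\<in>z H. compose (- F0) H a = Zero"
        "\<forall>i\<in>?I. compose (- F0) H i = - H i" "\<forall>i\<in>?J. compose (- F0) H i = H i"
        using F0H by (force simp: sign_vector_le_iff compose_apply)+
    qed auto
    ultimately show ?thesis using False eq by (simp add: H_def)
  qed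
qed

lemma exists_covector_ge:
  assumes "G \<in> L" "\<forall>b\<in>B. G b = Zero" "G e = Zero" "e \<notin> cl B" "e \<in> E" "B \<subseteq> E"
  obtains X where "X \<in> L" "\<forall>b\<in>B. X b = Zero" "X e = Pos" "G \<le> X"
proof -
  obtain Y where Y: "Y \<in> L" "\<forall>b\<in>B. Y b = Zero" "Y e \<noteq> Zero"
    using not_mem_closureE assms by blast
  define Y' where "Y' = (if Y e = Pos then Y else - Y)"
  have Y': "Y' \<in> L" "\<forall>b\<in>B. Y' b = Zero" "Y' e = Pos"
    using Y symmetry by (cases "Y e"; simp add: Y'_def)+
  show thesis
  proof (rule that)
    show "compose G Y' \<in> L" "\<forall>b\<in>B. compose G Y' b = Zero" "compose G Y' e = Pos" "G \<le> compose G Y'"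
      using Y' assms composition by (auto simp: compose_apply compose_ge)
  qed
qed

text \<open>
  The Euler characteristic of the complex of those faces of the affine space \<open>{F. F e = +}\<close>
  above \<open>F0\<close> which are bounded relative to \<open>F0\<close>.
\<close>

lemma sum_bounded_faces:
  assumes "F0 \<in> L" "e \<in> z F0" "B \<subseteq> z F0"
  shows "(\<Sum>F | F \<in> L \<and> F e = Pos \<and> face e F = F0 \<and> B \<subseteq> z F. sg (z F)) =
    (if e \<in> cl B then 0 else - sg (z F0))"
proof -
  let ?Q = "{F. F \<in> L \<and> F0 \<le> F \<and> F e = Pos \<and> B \<subseteq> z F}"
  let ?R = "{G. G \<in> L \<and> F0 \<le> G \<and> G e = Zero \<and> B \<subseteq> z G}"
  have e: "e \<in> E" "F0 e = Zero" and BE: "B \<subseteq> E" using assms by auto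
  have fin: "finite ?Q" "finite ?R" using finite_covectors by auto
  \<comment> \<open>The elements of \<open>?Q\<close> above \<open>G\<close> form an open cone,
    which is empty exactly when vanishing on \<open>B\<close> forces vanishing at
    \<open>e\<close>.\<close>
  have inner: "(\<Sum>F | F \<in> ?Q \<and> G \<le> F. sg (z F)) = (if e \<in> cl B then 0 else sg B)" if G: "G \<in> ?R" for G
  proof (cases "e \<in> cl B")
    case True
    have none: "{F \<in> ?Q. G \<le> F} = {}"
    proof (rule ccontr)
      assume "{F \<in> ?Q. G \<le> F} \<noteq> {}"
      then obtain F where F: "F \<in> L" "F e = Pos" "B \<subseteq> z F" by blast
      then have "e \<in> z F" using True mem_closure_iff by blast
      then show False using F by simp
    qed
    show ?thesis unfolding none using True by simp
  next
    case False
    have GB: "\<forall>b\<in>B. G b = Zero" using G by auto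
    then obtain X where X: "X \<in> L" "\<forall>b\<in>B. X b = Zero" "X e = Pos" "G \<le> X"
      using exists_covector_ge[of G B e] False G e BE by blast
    let ?I = "insert e {i \<in> E. G i \<noteq> Zero}"
    have "{F \<in> ?Q. G \<le> F} = cone B ?I X"
    proof (intro Set.set_eqI iffI)
      fix F assume "F \<in> {F \<in> ?Q. G \<le> F}"
      then show "F \<in> cone B ?I X"
        using X unfolding cone_def sign_vector_le_iff by (simp add: subset_iff) metis
    next
      fix F assume F: "F \<in> cone B ?I X"
      have GF: "G \<le> F"
        unfolding sign_vector_le_iff
      proof
        show "G i = Zero \<or> G i = F i" for i
          using F X(4) outside_ground[of G i] G unfolding cone_def sign_vector_le_iff
          by (cases "i \<in> E") force+
      qed
      moreover have "F0 \<le> F" using GF G order.trans by blast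
      moreover have "B \<subseteq> z F" using F BE by (auto simp: cone_def)
      ultimately show "F \<in> {F \<in> ?Q. G \<le> F}" using F X by (simp add: cone_def)
    qed
    moreover have "(\<Sum>F\<in>cone B ?I X. sg (z F)) = sg B"
    proof (rule euler_cone)
      show "\<forall>i\<in>?I. X i \<noteq> Zero" using X by (force simp: sign_vector_le_iff)
    qed (use X BE e in \<open>auto simp: cone_def\<close>)
    ultimately show ?thesis using False by simp
  qed
  have "{F. F \<in> L \<and> F e = Pos \<and> face e F = F0 \<and> B \<subseteq> z F} = {F \<in> ?Q. face e F = F0}"
    using face_le by auto
  \<comment> \<open>With the extra factor, the condition \<open>face e F = F0\<close> takes the form
    computed in \<open>sum_faces_in_hyperplane\<close> and turns into a sum over faces
    \<open>G\<close> in the hyperplane; the double sum is then swapped.\<close>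
  then have "sg (z F0) * (\<Sum>F | F \<in> L \<and> F e = Pos \<and> face e F = F0 \<and> B \<subseteq> z F. sg (z F)) =
      (\<Sum>F\<in>?Q. sg (z F) * (if face e F = F0 then sg (z F0) else 0))"
    using fin by (simp only: sum.inter_filter sum_distrib_left) (auto intro!: sum.cong)
  also have "\<dots> = (\<Sum>F\<in>?Q. sg (z F) * (\<Sum>G\<in>?R. if G \<le> F then sg (z G) else 0))"
  proof (rule sum.cong[OF refl])
    fix F assume F: "F \<in> ?Q"
    have "{G \<in> ?R. G \<le> F} = {G. G \<in> L \<and> F0 \<le> G \<and> G \<le> F \<and> G e = Zero}"
      using F zero_set_antimono by blast
    then show "sg (z F) * (if face e F = F0 then sg (z F0) else 0) =
      sg (z F) * (\<Sum>G\<in>?R. if G \<le> F then sg (z G) else 0)"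
      using sum_faces_in_hyperplane[of F0 F e] assms F e fin
      by (simp add: sum.inter_filter[symmetric])
  qed
  also have "\<dots> = (\<Sum>F\<in>?Q. \<Sum>G\<in>?R. if G \<le> F then sg (z G) * sg (z F) else 0)"
    by (simp add: sum_distrib_left if_distrib[of "\<lambda>x. _ * x"] mult.commute cong: if_cong)
  also have "\<dots> = (\<Sum>G\<in>?R. \<Sum>F\<in>?Q. if G \<le> F then sg (z G) * sg (z F) else 0)"
    by (rule sum.swap)
  also have "\<dots> = (\<Sum>G\<in>?R. sg (z G) * (\<Sum>F | F \<in> ?Q \<and> G \<le> F. sg (z F)))"
    using fin by (simp only: sum.inter_filter sum_distrib_left) (auto intro!: sum.cong)
  also have "\<dots> = (\<Sum>G\<in>?R. sg (z G)) * (if e \<in> cl B then 0 else sg B)"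
    using inner by (simp add: sum_distrib_right)
  \<comment> \<open>The remaining sum over \<open>G\<close> is again over an open cone, now inside
    the subspace where \<open>insert e B\<close> vanishes; this is where the minus sign of
    \<open>sg_insert\<close> comes from.\<close>
  also have "?R = cone (insert e B) {i \<in> E. F0 i \<noteq> Zero} F0"
  proof (intro Set.set_eqI iffI)
    fix F assume F: "F \<in> cone (insert e B) {i \<in> E. F0 i \<noteq> Zero} F0"
    then have "F0 i = Zero \<or> F0 i = F i" for i
      using outside_ground[of F0 i] assms(1) by (cases "i \<in> E") (force simp: cone_def)+
    then show "F \<in> ?R" using F BE by (auto simp: cone_def sign_vector_le_iff)
  qed (force simp: cone_def sign_vector_le_iff)
  also have "(\<Sum>G\<in>\<dots>. sg (z G)) = sg (insert e B)"
    using assms e BE by (intro euler_cone) (auto simp: cone_def)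
  finally have "sg (z F0) * (sg (z F0) * (\<Sum>F | F \<in> L \<and> F e = Pos \<and> face e F = F0 \<and> B \<subseteq> z F. sg (z F))) =
      sg (z F0) * (sg (insert e B) * (if e \<in> cl B then 0 else sg B))" by simp
  then show ?thesis
    using sg_insert[OF BE e(1)] by (auto simp flip: mult.assoc)
qed

section \<open>Restriction of the matroid to a subset of the ground set\<close>

lemma flats_restriction: "A \<subseteq> E \<Longrightarrow> flats (Mat A (restriction L A)) = (\<lambda>B. B \<inter> A) ` flats (Mat E L)"
proof -
  assume "A \<subseteq> E"
  then have "zero_set A (\<lambda>e. if e \<in> A then F e else Zero) = z F \<inter> A" for F
    by (auto simp: zero_set_def)
  then show ?thesis by (simp add: Mat_def restriction_def image_image)
qed

lemma closure_restriction:
  assumes "A \<subseteq> E" "B \<subseteq> A"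
  shows "closure_of_set (Mat A (restriction L A)) B = cl B \<inter> A"
proof -
  \<comment> \<open>As \<open>E\<close> is a flat, some flat contains \<open>B\<close>; the
    intersections run over nonempty families and commute with cutting down to
    \<open>A\<close>.\<close>
  have "E \<in> flats (Mat E L)" using zero by (force simp: flats_Mat)
  then show ?thesis using assms unfolding closure_of_set_def flats_restriction[OF assms(1)] by blast
qed

lemma independent_restriction:
  assumes "A \<subseteq> E" "I \<subseteq> A"
  shows "independent (Mat A (restriction L A)) I \<longleftrightarrow> independent (Mat E L) I"
proof -
  have "I - {e} \<subseteq> A" for e using assms by blast
  then show ?thesis
    using assms by (auto simp: independent_def closure_restriction)
qed

lemma matroid_rank_restriction:
  assumes "A \<subseteq> E" "B \<subseteq> A"
  shows "matroid_rank (Mat A (restriction L A)) B = rk B"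
proof -
  have "{I. I \<subseteq> B \<and> independent (Mat A (restriction L A)) I} = {I. I \<subseteq> B \<and> independent (Mat E L) I}"
    using independent_restriction[OF assms(1)] assms(2) by blast
  then show ?thesis by (simp add: matroid_rank_def)
qed

lemma crapo_beta_restriction:
  assumes "A \<subseteq> E" "e \<in> A"
  shows "crapo_beta (Mat A (restriction L A)) =
    - sg A * (\<Sum>B | B \<subseteq> A \<and> e \<notin> cl B. (- 1) ^ card B)"
proof -
  interpret N: exchange_flats "Mat A (restriction L A)"
  proof
    show "finite (ground (Mat A (restriction L A)))"
      using assms finite_ground finite_subset by (auto simp: Mat_def)
  next
    fix B e f
    assume *: "B \<subseteq> ground (Mat A (restriction L A))" "e \<in> ground (Mat A (restriction L A))"
      "f \<in> ground (Mat A (restriction L A))"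
      "f \<in> closure_of_set (Mat A (restriction L A)) (insert e B)"
      "f \<notin> closure_of_set (Mat A (restriction L A)) B"
    then have g: "B \<subseteq> A" "e \<in> A" "f \<in> A" by (auto simp: Mat_def)
    have "f \<in> cl (insert e B)" "f \<notin> cl B"
      using * g assms(1) by (simp_all add: closure_restriction)
    moreover have "B \<subseteq> E" "e \<in> E" "f \<in> E" using g assms(1) by auto
    ultimately have "e \<in> cl (insert f B)" using exchange_property by blast
    then show "e \<in> closure_of_set (Mat A (restriction L A)) (insert f B)"
      using g assms(1) by (simp add: closure_restriction)
  qed
  have "{B. B \<subseteq> A \<and> e \<notin> closure_of_set (Mat A (restriction L A)) B} = {B. B \<subseteq> A \<and> e \<notin> cl B}"
    using assms by (auto simp: closure_restriction)
  moreover have "ground (Mat A (restriction L A)) = A" by (simp add: Mat_def)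
  ultimately show ?thesis
    using N.crapo_beta_eq[of e] assms by (simp add: matroid_rank_restriction sg_def)
qed

end

section \<open>Topes of a loopless oriented matroid and of its contractions\<close>

context loopless_oriented_matroid
begin

text \<open>If \<open>P e\<close> were zero, composing \<open>P\<close> with a covector that is
  nonzero at \<open>e\<close> would give something strictly larger; such a covector exists by
  looplessness.\<close>

lemma topes_iff: "P \<in> topes L \<longleftrightarrow> P \<in> L \<and> z P = {}"
proof
  assume P: "P \<in> topes L"
  then have PL: "P \<in> L" by (simp add: topes_def)
  have "P e \<noteq> Zero" if e: "e \<in> E" for e
  proof
    assume "P e = Zero"
    obtain X where X: "X \<in> L" "X e \<noteq> Zero" using loopless[OF e] by blast
    have "\<forall>F\<in>L. P \<le> F \<longrightarrow> F = P" using P by (simp add: topes_def)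
    then have "compose P X = P" using composition[OF PL X(1)] compose_ge[of P X] by blast
    then show False using X \<open>P e = Zero\<close> by (metis compose_apply)
  qed
  then show "P \<in> L \<and> z P = {}" using PL by auto
next
  assume P: "P \<in> L \<and> z P = {}"
  have "F = P" if F: "F \<in> L" "P \<le> F" for F
  proof (rule covector_eqI)
    show "F e = P e" if "e \<in> E" for e
      using P F that by (force simp: sign_vector_le_iff)
  qed (use F P in auto)
  then show "P \<in> topes L" using P by (simp add: topes_def)
qed

lemma tope_covector: "P \<in> topes L \<Longrightarrow> P \<in> L"
  by (simp add: topes_iff)

lemma tope_nonzero: "P \<in> topes L \<Longrightarrow> e \<in> E \<Longrightarrow> P e \<noteq> Zero"
  using topes_iff zero_set_iff by blast

lemma topeI: "P \<in> L \<Longrightarrow> (\<And>e. e \<in> E \<Longrightarrow> P e \<noteq> Zero) \<Longrightarrow> P \<in> topes L"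
  by (auto simp: topes_iff)

lemma topes_contraction:
  assumes "A \<in> flats (Mat E L)"
  shows "topes (contraction E L A) = {F \<in> L. z F = A}"
proof -
  obtain X where X: "X \<in> L" "A = z X" using assms by (auto simp: flats_Mat)
  \<comment> \<open>Forgetting the entries in \<open>A\<close> changes nothing, as they are zero;
    the contraction is literally a subset of \<open>L\<close>.\<close>
  have "(\<lambda>e. if e \<in> E - A then F e else Zero) = F" if "F \<in> L" "A \<subseteq> z F" for F
    using that outside_ground[OF that(1)] by (auto simp: fun_eq_iff)
  then have C: "contraction E L A = {F \<in> L. A \<subseteq> z F}"
    unfolding contraction_def restriction_def by (auto simp: image_iff)
  show ?thesis
  proof (intro Set.set_eqI iffI)
    fix P assume "P \<in> topes (contraction E L A)"
    then have P: "P \<in> L" "A \<subseteq> z P" "\<And>F. F \<in> L \<Longrightarrow> A \<subseteq> z F \<Longrightarrow> P \<le> F \<Longrightarrow> F = P"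
      by (auto simp: topes_def C)
    \<comment> \<open>\<open>X\<close> has zero set exactly \<open>A\<close>, so a maximal
      \<open>P\<close>, which absorbs \<open>X\<close>, cannot vanish outside
      \<open>A\<close>.\<close>
    have "A \<subseteq> z (compose P X)" using P(2) X by (force simp: compose_apply)
    then have "compose P X = P" using P X composition compose_ge by blast
    then have "P e = Zero \<Longrightarrow> X e = Zero" for e by (metis compose_apply)
    then show "P \<in> {F \<in> L. z F = A}" using P X by auto
  next
    fix P assume P: "P \<in> {F \<in> L. z F = A}"
    have "F = P" if F: "F \<in> L" "A \<subseteq> z F" "P \<le> F" for F
    proof (rule covector_eqI)
      show "F e = P e" if "e \<in> E" for e
        using P F that by (force simp: sign_vector_le_iff)
    qed (use F P in auto)
    then show "P \<in> topes (contraction E L A)" using P by (auto simp: topes_def C)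
  qed
qed

text \<open>The indicator of \<open>z F = {}\<close> is written as an alternating sum over the
  subsets \<open>B\<close> of \<open>z F\<close>, which turns the count of topes into sums over all
  relatively bounded faces. These are known from \<open>sum_bounded_faces\<close>, and the result is
  the formula for beta in \<open>crapo_beta_restriction\<close>.\<close>

lemma card_topes_with_face:
  assumes "F0 \<in> L" "e \<in> z F0"
  shows "int (card {D \<in> topes L. D e = Pos \<and> face e D = F0}) =
    crapo_beta (Mat (z F0) (restriction L (z F0)))"
proof -
  let ?A = "z F0" and ?S = "{F. F \<in> L \<and> F e = Pos \<and> face e F = F0}"
  have fin: "finite ?S" using finite_covectors by simp
  have "int (card {D \<in> topes L. D e = Pos \<and> face e D = F0}) = (\<Sum>F\<in>?S. if z F = {} then 1 else 0)"
    using fin by (simp add: sum.inter_filter[symmetric] topes_iff conj_ac)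
  also have "\<dots> = (\<Sum>F\<in>?S. \<Sum>B\<in>Pow ?A. if B \<subseteq> z F then (- 1) ^ card B * sg (z F) else 0)"
  proof (rule sum.cong[OF refl])
    fix F assume "F \<in> ?S"
    then have "z F \<subseteq> ?A" using face_le[of e F] zero_set_antimono by blast
    then have "{B \<in> Pow ?A. B \<subseteq> z F} = Pow (z F)" by blast
    then have "(\<Sum>B\<in>Pow ?A. if B \<subseteq> z F then (- 1) ^ card B * sg (z F) else 0) =
        (\<Sum>B\<in>Pow (z F). (- 1) ^ card B) * sg (z F)"
      by (simp add: sum.inter_filter[symmetric] sum_distrib_right)
    also have "\<dots> = (if z F = {} then 1 else 0)"
      by (auto simp: sum_Pow_alternating sg_empty)
    finally show "(if z F = {} then 1 else 0) =
      (\<Sum>B\<in>Pow ?A. if B \<subseteq> z F then (- 1) ^ card B * sg (z F) else 0)" ..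
  qed
  also have "\<dots> = (\<Sum>B\<in>Pow ?A. \<Sum>F\<in>?S. if B \<subseteq> z F then (- 1) ^ card B * sg (z F) else 0)"
    by (rule sum.swap)
  also have "\<dots> = (\<Sum>B\<in>Pow ?A. (- 1) ^ card B * (if e \<in> cl B then 0 else - sg ?A))"
  proof (rule sum.cong[OF refl])
    fix B assume "B \<in> Pow ?A"
    then have "(\<Sum>F | F \<in> L \<and> F e = Pos \<and> face e F = F0 \<and> B \<subseteq> z F. sg (z F)) =
        (if e \<in> cl B then 0 else - sg ?A)"
      using sum_bounded_faces[OF assms, of B] by simp
    moreover have "(\<Sum>F\<in>?S. if B \<subseteq> z F then (- 1) ^ card B * sg (z F) else 0) =
        (- 1) ^ card B * (\<Sum>F | F \<in> L \<and> F e = Pos \<and> face e F = F0 \<and> B \<subseteq> z F. sg (z F))"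
      using fin by (simp add: sum.inter_filter[symmetric] sum_distrib_left conj_ac)
    ultimately show "(\<Sum>F\<in>?S. if B \<subseteq> z F then (- 1) ^ card B * sg (z F) else 0) =
      (- 1) ^ card B * (if e \<in> cl B then 0 else - sg ?A)" by simp
  qed
  also have "\<dots> = (\<Sum>B\<in>Pow ?A. if e \<notin> cl B then (- 1) ^ card B * (- sg ?A) else 0)"
    by (intro sum.cong) auto
  also have "\<dots> = - sg ?A * (\<Sum>B | B \<subseteq> ?A \<and> e \<notin> cl B. (- 1) ^ card B)"
    by (simp add: sum.inter_filter[symmetric] sum_distrib_left sum_distrib_right mult.commute sum_negf)
  finally show ?thesis
    using crapo_beta_restriction[OF zero_set_subset assms(2)] by simp
qed

text \<open>The condition \<open>compose F P = D\<close> forces \<open>F\<close> to be nonzero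
  wherever \<open>P\<close> is opposite to \<open>D\<close> and leaves a weak inequality elsewhere.
  The faces thus form a half-open cone, whose sum is zero unless no weak inequality remains; then
  \<open>D\<close> is the only face.\<close>

lemma sum_faces_of_tope:
  assumes "F0 \<in> L" "D \<in> topes L" "P \<in> topes L" "F0 \<le> D"
  shows "(\<Sum>F | F \<in> L \<and> F0 \<le> F \<and> F \<le> D \<and> compose F P = D. sg (z F)) =
    (if compose F0 P = compose F0 (- D) then 1 else 0)"
proof -
  note DL = tope_covector[OF assms(2)] and PL = tope_covector[OF assms(3)]
  let ?I = "{i \<in> E. F0 i \<noteq> Zero \<or> P i = - D i}"
  let ?J = "{i \<in> E. F0 i = Zero \<and> P i \<noteq> - D i}"
  have J: "P j = D j" if "j \<in> ?J" for j
    using that tope_nonzero[OF assms(2), of j] tope_nonzero[OF assms(3), of j]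
      sign_trichotomy[of "D j" "P j"] by auto
  have F0D: "F0 i = Zero \<or> F0 i = D i" for i using assms(4) by (simp add: sign_vector_le_iff)
  have set_eq: "{F. F \<in> L \<and> F0 \<le> F \<and> F \<le> D \<and> compose F P = D} = half_open_cone {} ?I ?J D"
  proof (intro Set.set_eqI iffI)
    fix F assume "F \<in> {F. F \<in> L \<and> F0 \<le> F \<and> F \<le> D \<and> compose F P = D}"
    then have F: "F \<in> L" "\<And>i. F0 i = Zero \<or> F0 i = F i" "\<And>i. F i = Zero \<or> F i = D i"
      and "compose F P = D"
      by (auto simp: sign_vector_le_iff)
    then have F4: "F i = Zero \<Longrightarrow> P i = D i" for i by (auto simp: compose_apply)
    have "F i = D i" if "i \<in> ?I" for i
      using that F(2,3)[of i] F4[of i] F0D[of i] tope_nonzero[OF assms(2), of i] by auto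
    then show "F \<in> half_open_cone {} ?I ?J D" using F by (auto simp: half_open_cone_def cone_def)
  next
    fix F assume "F \<in> half_open_cone {} ?I ?J D"
    then have F: "F \<in> L" "\<And>i. i \<in> ?I \<Longrightarrow> F i = D i" "\<And>i. i \<in> ?J \<Longrightarrow> F i = Zero \<or> F i = D i"
      by (auto simp: half_open_cone_def cone_def)
    have "(F0 i = Zero \<or> F0 i = F i) \<and> (F i = Zero \<or> F i = D i) \<and> (F i = Zero \<longrightarrow> P i = D i)" for i
    proof (cases "i \<in> E")
      case True
      then show ?thesis
        using F(2,3)[of i] F0D[of i] J[of i] tope_nonzero[OF assms(2) True]
        by (cases "P i = - D i") auto
    next
      case False
      then show ?thesis using F(1) assms(1) PL DL by (simp add: outside_ground)
    qed
    then show "F \<in> {F. F \<in> L \<and> F0 \<le> F \<and> F \<le> D \<and> compose F P = D}"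
      using F(1) by (auto simp: sign_vector_le_iff compose_def fun_eq_iff)
  qed
  have compose_eq: "compose F0 P = compose F0 (- D) \<longleftrightarrow> ?J = {}"
  proof
    assume "compose F0 P = compose F0 (- D)"
    then have "compose F0 P i = compose F0 (- D) i" for i by simp
    then have "F0 i = Zero \<Longrightarrow> P i = - D i" for i
      unfolding compose_apply by (metis fun_Compl_def)
    then show "?J = {}" by blast
  next
    assume "?J = {}"
    then have "F0 i = Zero \<Longrightarrow> P i = - D i" for i
      using DL PL by (cases "i \<in> E") (auto simp: outside_ground)
    then show "compose F0 P = compose F0 (- D)" by (auto simp: compose_def fun_eq_iff)
  qed
  show ?thesis
  proof (cases "?J = {}")
    case True
    then have "?I = E" by blast
    then have "half_open_cone {} ?I ?J D = {D}"
      using True DL covector_eqI by (auto simp: half_open_cone_def cone_def)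
    moreover have "z D = {}" using assms(2) topes_iff by blast
    ultimately show ?thesis using compose_eq True set_eq by (simp only: sg_empty sum.insert sum.empty) (simp add: sg_empty)
  next
    case False
    have "(\<Sum>F\<in>half_open_cone {} ?I ?J D. sg (z F)) = 0"
    proof (rule euler_half_open_cone)
      \<comment> \<open>The witness \<open>W\<close>: on the support of \<open>F0\<close> it is
        \<open>- D\<close>, and elsewhere \<open>P\<close> is \<open>- D\<close> on
        \<open>?I\<close> and \<open>D\<close> on \<open>?J\<close>.\<close>
      show "compose (- F0) P \<in> L" using assms(1) PL composition symmetry by blast
      show "\<forall>i\<in>?I \<union> ?J. D i \<noteq> Zero" using tope_nonzero[OF assms(2)] by auto
      show "\<forall>i\<in>?I. compose (- F0) P i = - D i" using F0D by (auto simp: compose_apply)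
      show "\<forall>j\<in>?J. compose (- F0) P j = D j" using J by (auto simp: compose_apply)
    qed (use False in auto)
    then show ?thesis using False set_eq compose_eq by (simp only: if_False)
  qed
qed

end

section \<open>Determinants of kernels\<close>

text \<open>Rows and columns are addressed by list elements instead of positions, so that matrices
  can be treated as functions of pairs of topes.\<close>

definition kernel_mat :: "'b list \<Rightarrow> ('b \<Rightarrow> 'b \<Rightarrow> 'a) \<Rightarrow> 'a mat" where
  "kernel_mat xs f = mat (length xs) (length xs) (\<lambda>(i, j). f (xs ! i) (xs ! j))"

definition kdet :: "'b list \<Rightarrow> ('b \<Rightarrow> 'b \<Rightarrow> 'a :: comm_ring_1) \<Rightarrow> 'a" where
  "kdet xs f = det (kernel_mat xs f)"

lemma kernel_mat_carrier [simp]: "kernel_mat xs f \<in> carrier_mat (length xs) (length xs)"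
  by (simp add: kernel_mat_def)

lemma sum_nth_distinct:
  assumes "distinct xs"
  shows "(\<Sum>i = 0..<length xs. g (xs ! i)) = sum g (set xs)"
  using sum.reindex_bij_betw[OF bij_betw_nth[OF assms refl refl], of g] by (simp add: atLeast0LessThan)

lemma prod_nth_distinct:
  assumes "distinct xs"
  shows "(\<Prod>i = 0..<length xs. g (xs ! i)) = prod g (set xs)"
  using prod.reindex_bij_betw[OF bij_betw_nth[OF assms refl refl], of g] by (simp add: atLeast0LessThan)

lemma kdet_cong:
  assumes "\<And>x y. x \<in> set xs \<Longrightarrow> y \<in> set xs \<Longrightarrow> f x y = g x y"
  shows "kdet xs f = kdet xs g"
proof -
  have "kernel_mat xs f = kernel_mat xs g"
    using assms by (intro eq_matI) (auto simp: kernel_mat_def)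
  then show ?thesis by (simp add: kdet_def)
qed

lemma kernel_mat_mult:
  assumes "distinct xs"
  shows "kernel_mat xs f * kernel_mat xs g = kernel_mat xs (\<lambda>x y. \<Sum>w\<in>set xs. f x w * g w y)"
  using sum_nth_distinct[OF assms]
  by (intro eq_matI) (auto simp: kernel_mat_def scalar_prod_def)

lemma kdet_mult:
  assumes "distinct xs"
  shows "kdet xs (\<lambda>x y. \<Sum>w\<in>set xs. f x w * g w y) = kdet xs f * kdet xs g"
  unfolding kdet_def kernel_mat_mult[OF assms, symmetric] by (rule det_mult[OF kernel_mat_carrier kernel_mat_carrier])

lemma (in comm_ring_hom) hom_kdet: "hom (kdet xs f) = kdet xs (\<lambda>x y. hom (f x y))"
proof -
  have "map_mat hom (kernel_mat xs f) = kernel_mat xs (\<lambda>x y. hom (f x y))"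
    by (intro eq_matI) (auto simp: kernel_mat_def)
  then show ?thesis by (simp add: kdet_def flip: hom_det)
qed

text \<open>
  A permutation contributing to the determinant moves no index: its moved indices would lie in
  \<open>S\<close>, while their images would not.
\<close>

lemma kdet_block_triangular:
  assumes "distinct xs"
    and "\<And>x y. x \<in> set xs \<Longrightarrow> y \<in> set xs \<Longrightarrow> x \<noteq> y \<Longrightarrow> f x y \<noteq> 0 \<Longrightarrow> x \<in> S \<and> y \<notin> S"
  shows "kdet xs f = (\<Prod>x\<in>set xs. f x x)"
proof -
  let ?n = "length xs"
  let ?t = "\<lambda>p. signof p * (\<Prod>i = 0..<?n. kernel_mat xs f $$ (i, p i))"
  have "?t p = 0" if p: "p permutes {0..<?n}" "p \<noteq> id" for p
  proof -
    obtain i where i: "p i \<noteq> i" using p(2) by (auto simp: fun_eq_iff)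
    then have in1: "i < ?n" using p(1) by (metis atLeastLessThan_iff le0 permutes_def)
    have in2: "p i < ?n" using permutes_in_image[OF p(1), of i] in1 by simp
    have in3: "p (p i) < ?n" using permutes_in_image[OF p(1), of "p i"] in2 by simp
    have ne: "p (p i) \<noteq> p i" using i permutes_inj[OF p(1)] by (auto dest: injD)
    \<comment> \<open>Either the entry at \<open>i\<close> vanishes, or \<open>p i\<close> points
      outside \<open>S\<close> and the entry in the next row \<open>p i\<close> vanishes.\<close>
    have "\<exists>j\<in>{0..<?n}. kernel_mat xs f $$ (j, p j) = 0"
    proof (cases "xs ! i \<in> S \<and> xs ! (p i) \<notin> S")
      case True
      moreover have "xs ! p i \<noteq> xs ! p (p i)"
        using ne assms(1) in2 in3 by (simp add: nth_eq_iff_index_eq)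
      ultimately have "f (xs ! p i) (xs ! p (p i)) = 0"
        using assms(2)[of "xs ! p i" "xs ! p (p i)"] in2 in3 by auto
      then show ?thesis using in2 in3 by (intro bexI[of _ "p i"]) (auto simp: kernel_mat_def)
    next
      case False
      moreover have "xs ! i \<noteq> xs ! p i"
        using i assms(1) in1 in2 by (simp add: nth_eq_iff_index_eq)
      ultimately have "f (xs ! i) (xs ! p i) = 0"
        using assms(2)[of "xs ! i" "xs ! p i"] in1 in2 by auto
      then show ?thesis using in1 in2 by (intro bexI[of _ i]) (auto simp: kernel_mat_def)
    qed
    then show ?thesis by (simp add: prod_zero)
  qed
  then have "(\<Sum>p | p permutes {0..<?n}. ?t p) = (\<Sum>p\<in>{id}. ?t p)"
    by (intro sum.mono_neutral_right) (auto simp: permutes_id finite_permutations)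
  also have "\<dots> = (\<Prod>i = 0..<?n. f (xs ! i) (xs ! i))"
    by (simp add: kernel_mat_def)
  finally show ?thesis
    unfolding kdet_def det_def'[OF kernel_mat_carrier]
    using prod_nth_distinct[OF assms(1), of "\<lambda>x. f x x"] by simp
qed

text \<open>A column of the adjugate solves the linear system for a unit vector up to the factor
  \<open>kdet xs f\<close>, without any division.\<close>

lemma kdet_adjugate:
  assumes "distinct xs" "y \<in> set xs"
  obtains x where "\<And>p. p \<in> set xs \<Longrightarrow> (\<Sum>w\<in>set xs. f p w * x w) = (if p = y then kdet xs f else 0)"
proof -
  let ?A = "kernel_mat xs f" and ?n = "length xs"
  obtain j where j: "j < ?n" "xs ! j = y" using assms(2) by (auto simp: in_set_conv_nth)
  define B where "B = adj_mat ?A"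
  have B: "B \<in> carrier_mat ?n ?n" "?A * B = kdet xs f \<cdot>\<^sub>m 1\<^sub>m ?n"
    using adj_mat[of ?A ?n] by (simp_all add: B_def kdet_def)
  define idx where "idx w = (THE i. i < ?n \<and> xs ! i = w)" for w
  have idx: "idx (xs ! i) = i" if "i < ?n" for i
    unfolding idx_def using that assms(1) by (intro the_equality) (auto simp: nth_eq_iff_index_eq)
  show thesis
  proof (rule that)
    fix p assume "p \<in> set xs"
    then obtain i where i: "i < ?n" "xs ! i = p" by (auto simp: in_set_conv_nth)
    have "(\<Sum>w\<in>set xs. f p w * B $$ (idx w, j)) = (\<Sum>k = 0..<?n. f p (xs ! k) * B $$ (idx (xs ! k), j))"
      by (rule sum_nth_distinct[OF assms(1), symmetric])
    also have "\<dots> = (?A * B) $$ (i, j)"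
      using i j B(1) by (auto simp: kernel_mat_def scalar_prod_def idx intro!: sum.cong)
    also have "\<dots> = (if p = y then kdet xs f else 0)"
      unfolding B(2) using i j assms(1) by (auto simp: nth_eq_iff_index_eq)
    finally show "(\<Sum>w\<in>set xs. f p w * B $$ (idx w, j)) = (if p = y then kdet xs f else 0)" .
  qed
qed

text \<open>The matrix splits into 2 by 2 blocks along the orbits of \<open>\<iota>\<close>, each
  with one element in \<open>S\<close>. Multiplication by the unimodular \<open>?g\<close> clears
  the off-diagonal entries in the columns of \<open>S\<close>, so that the product \<open>?h\<close>
  is block triangular.\<close>

lemma kdet_involution:
  assumes "distinct xs"
    and iota: "\<And>x. x \<in> set xs \<Longrightarrow> \<iota> x \<in> set xs \<and> \<iota> (\<iota> x) = x \<and> (\<iota> x \<in> S \<longleftrightarrow> x \<notin> S)"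
  shows "kdet xs (\<lambda>x y. (if x = y then 1 else 0) + (if x = \<iota> y then c y else 0)) =
    (\<Prod>x | x \<in> set xs \<and> x \<in> S. 1 - c x * c (\<iota> x))"
proof -
  let ?f = "\<lambda>x y. (if x = y then 1 else 0) + (if x = \<iota> y then c y else 0)"
  let ?g = "\<lambda>x y. (if x = y then 1 else 0) - (if x = \<iota> y \<and> y \<in> S then c y else 0)"
  let ?h = "\<lambda>x y. (if x = y then if y \<in> S then 1 - c y * c (\<iota> y) else 1 else 0) +
    (if x = \<iota> y \<and> y \<notin> S then c y else 0)"
  have ne: "\<iota> x \<noteq> x" if "x \<in> set xs" for x using iota[OF that] by auto
  have "kdet xs ?f * kdet xs ?g = kdet xs (\<lambda>x y. \<Sum>w\<in>set xs. ?f x w * ?g w y)"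
    by (rule kdet_mult[OF assms(1), symmetric])
  also have "\<dots> = kdet xs ?h"
  proof (rule kdet_cong)
    fix x y assume x: "x \<in> set xs" and y: "y \<in> set xs"
    have "(\<Sum>w\<in>set xs. ?f x w * ?g w y) =
        (\<Sum>w\<in>set xs. if w = y then ?f x w else 0) -
        (\<Sum>w\<in>set xs. if w = \<iota> y then ?f x w * (if y \<in> S then c y else 0) else 0)"
      unfolding sum_subtractf[symmetric] by (rule sum.cong) (auto simp: right_diff_distrib)
    also have "\<dots> = ?f x y - ?f x (\<iota> y) * (if y \<in> S then c y else 0)"
      using y iota[OF y] by (simp add: sum.delta')
    also have "\<dots> = ?h x y" using iota[OF y] ne[OF y] by (auto simp: mult.commute)
    finally show "(\<Sum>w\<in>set xs. ?f x w * ?g w y) = ?h x y" .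
  qed
  also have "\<dots> = (\<Prod>x\<in>set xs. ?h x x)"
    using iota by (intro kdet_block_triangular[OF assms(1), where S = S]) (auto split: if_splits)
  also have "\<dots> = (\<Prod>x\<in>set xs. if x \<in> S then 1 - c x * c (\<iota> x) else 1)"
    using ne by (intro prod.cong) (auto dest: sym)
  also have "\<dots> = (\<Prod>x | x \<in> set xs \<and> x \<in> S. 1 - c x * c (\<iota> x))"
    by (simp add: prod.inter_filter)
  finally have "kdet xs ?f * kdet xs ?g = (\<Prod>x | x \<in> set xs \<and> x \<in> S. 1 - c x * c (\<iota> x))" .
  moreover have "kdet xs ?g = (\<Prod>x\<in>set xs. ?g x x)"
    using iota by (intro kdet_block_triangular[OF assms(1), where S = "- S"]) (auto split: if_splits)
  moreover have "(\<Prod>x\<in>set xs. ?g x x) = 1"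
    using ne by (intro prod.neutral) (auto dest: sym)
  ultimately show ?thesis by simp
qed

text \<open>Entries of the Varchenko matrix for arbitrary weights, so that single variables can be
  set to zero.\<close>

definition sep_prod :: "('e \<Rightarrow> 'a :: comm_ring_1) \<Rightarrow> 'e sign_vector \<Rightarrow> 'e sign_vector \<Rightarrow> 'a" where
  "sep_prod u P Q = (\<Prod>e\<in>Sep P Q. u e)"

section \<open>Products over separating sets of topes\<close>

context loopless_oriented_matroid
begin

lemma finite_topes: "finite (topes L)"
  by (rule finite_subset[OF _ finite_covectors]) (auto simp: topes_def)

lemma tope_sign_cases: "P \<in> topes L \<Longrightarrow> Q \<in> topes L \<Longrightarrow> e \<in> E \<Longrightarrow> P e = Q e \<or> P e = - Q e"
  using sign_trichotomy[of "Q e" "P e"] tope_nonzero by blast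

lemma Sep_topes:
  assumes "P \<in> topes L" "Q \<in> topes L"
  shows "Sep P Q = {e \<in> E. P e \<noteq> Q e}"
proof (intro Set.set_eqI iffI)
  fix e assume e: "e \<in> Sep P Q"
  then have "e \<in> E" using outside_ground[OF tope_covector[OF assms(1)]] by (auto simp: Sep_def)
  then show "e \<in> {e \<in> E. P e \<noteq> Q e}" using e by (auto simp: Sep_def)
next
  fix e assume "e \<in> {e \<in> E. P e \<noteq> Q e}"
  then show "e \<in> Sep P Q"
    using tope_sign_cases[OF assms, of e] tope_nonzero[OF assms(1), of e] by (auto simp: Sep_def)
qed

lemma compose_tope: "F \<in> L \<Longrightarrow> P \<in> topes L \<Longrightarrow> compose F P \<in> topes L"
  using composition tope_covector tope_nonzero by (intro topeI) (auto simp: compose_apply)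

lemma uminus_tope: "P \<in> topes L \<Longrightarrow> - P \<in> topes L"
  using symmetry tope_covector tope_nonzero by (intro topeI) auto

text \<open>On the support of \<open>F\<close> the tope \<open>compose F P\<close> agrees with
  \<open>Q\<close>, off the support with \<open>P\<close>; hence the separating set of
  \<open>P\<close> and \<open>Q\<close> splits disjointly.\<close>

lemma sep_prod_gate:
  assumes "F \<in> L" "P \<in> topes L" "Q \<in> topes L" "F \<le> Q"
  shows "sep_prod u P Q = sep_prod u P (compose F P) * sep_prod u (compose F P) Q"
proof -
  note FP = compose_tope[OF assms(1,2)]
  have "Sep P Q = Sep P (compose F P) \<union> Sep (compose F P) Q"
    "Sep P (compose F P) \<inter> Sep (compose F P) Q = {}"
    using assms(4) unfolding Sep_topes[OF assms(2,3)] Sep_topes[OF assms(2) FP] Sep_topes[OF FP assms(3)]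
    by (auto simp: compose_apply sign_vector_le_iff)
  moreover have "finite (Sep P (compose F P))" "finite (Sep (compose F P) Q)"
    using finite_ground by (simp_all add: Sep_topes[OF assms(2) FP] Sep_topes[OF FP assms(3)])
  ultimately show ?thesis by (simp add: sep_prod_def prod.union_disjoint)
qed

lemma sep_prod_self [simp]: "sep_prod u P P = 1"
  by (simp add: sep_prod_def Sep_def)

lemma sep_prod_update:
  assumes "P \<in> topes L" "Q \<in> topes L" "e \<in> E"
  shows "sep_prod (u(e := 0)) P Q = (if P e = Q e then sep_prod u P Q else 0)"
proof (cases "P e = Q e")
  case True
  then show ?thesis unfolding sep_prod_def Sep_topes[OF assms(1,2)]
    by (auto intro!: prod.cong)
next
  case False
  then have "(\<Prod>i\<in>{e \<in> E. P e \<noteq> Q e}. (u(e := 0)) i) = 0"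
    using assms(3) finite_ground by (intro prod_zero) auto
  then show ?thesis using False by (simp add: sep_prod_def Sep_topes[OF assms(1,2)])
qed

lemma sep_prod_vanishing:
  assumes "P \<in> topes L" "Q \<in> topes L" "\<And>e. e \<in> E \<Longrightarrow> u e = 0"
  shows "sep_prod u P Q = (if P = Q then 1 else 0)"
proof (cases "P = Q")
  case False
  then obtain e where "e \<in> E" "P e \<noteq> Q e"
    using covector_eqI tope_covector assms(1,2) by metis
  then have "(\<Prod>e\<in>{e \<in> E. P e \<noteq> Q e}. u e) = 0"
    using finite_ground assms(3) by (intro prod_zero) auto
  then show ?thesis using False by (simp add: sep_prod_def Sep_topes[OF assms(1,2)])
qed simp

text \<open>Reflection around \<open>F\<close> sends faces above \<open>F\<close> of one of the two
  topes to faces of the other, so the maximality of \<open>F\<close> carries over from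
  \<open>D\<close> to the opposite tope.\<close>

lemma antipode_face:
  assumes "D \<in> topes L" "F = face e D"
  shows "compose F (- D) \<in> topes L" "face e (compose F (- D)) = F"
    "compose F (- compose F (- D)) = D"
    "e \<in> E \<Longrightarrow> compose F (- D) e = - D e"
proof -
  have F: "F \<in> L" "F \<le> D" "F e = Zero" and max: "\<And>G. G \<in> L \<Longrightarrow> G \<le> D \<Longrightarrow> G e = Zero \<Longrightarrow> G \<le> F"
    using face_in face_le face_apply face_greatest assms(2) by auto
  show "compose F (- D) \<in> topes L" using compose_tope uminus_tope assms F by blast
  show "compose F (- D) e = - D e" if "e \<in> E" using F(3) by (simp add: compose_apply)
  show "compose F (- compose F (- D)) = D"
    using F(2) by (auto simp: compose_def fun_eq_iff sign_vector_le_iff)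
  let ?D' = "compose F (- D)"
  let ?G = "face e ?D'"
  have "F \<le> ?G" using F compose_ge by (intro face_greatest) auto
  have G: "?G \<in> L" "?G \<le> ?D'" "?G e = Zero" using face_in face_le face_apply by auto
  \<comment> \<open>The reflection of \<open>?G\<close> is a face of \<open>D\<close> with zero
    entry at \<open>e\<close>, so it cannot exceed \<open>F\<close>.\<close>
  have "compose F (- ?G) \<le> D"
    unfolding sign_vector_le_iff
  proof
    fix i
    have "?G i = Zero \<or> ?G i = ?D' i" "F i = Zero \<or> F i = D i"
      using G(2) F(2) by (auto simp: sign_vector_le_iff)
    then show "compose F (- ?G) i = Zero \<or> compose F (- ?G) i = D i"
      by (auto simp: compose_apply)
  qed
  then have "compose F (- ?G) \<le> F"
    using F G composition symmetry by (intro max) (auto simp: compose_apply)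
  then have "?G i = Zero" if "F i = Zero" for i
  proof -
    have "compose F (- ?G) i = Zero \<or> compose F (- ?G) i = F i"
      using \<open>compose F (- ?G) \<le> F\<close> by (simp add: sign_vector_le_iff)
    then show ?thesis using that by (simp add: compose_apply)
  qed
  moreover have "F i = Zero \<or> F i = ?G i" for i using \<open>F \<le> ?G\<close> by (simp add: sign_vector_le_iff)
  ultimately show "?G = F" by (metis ext)
qed

lemma sep_prod_antipode:
  assumes "D \<in> topes L" "F \<in> L" "F \<le> D"
  shows "sep_prod u (compose F (- D)) D = (\<Prod>i\<in>z F. u i)"
proof -
  have "compose F (- D) \<in> topes L" using compose_tope uminus_tope assms by blast
  moreover have "{i \<in> E. compose F (- D) i \<noteq> D i} = z F"
    using assms(3) tope_nonzero[OF assms(1)] by (auto simp: compose_apply sign_vector_le_iff)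
  ultimately show ?thesis using assms(1) by (simp add: sep_prod_def Sep_topes)
qed

end

section \<open>The Varchenko determinant\<close>

context loopless_oriented_matroid
begin

text \<open>
  The homomorphism \<open>h\<close> kills all variables and so maps the matrices below to (signed)
  identity matrices; this is how their determinants are seen to be nonzero.
\<close>

lemma hom_sep_prod:
  assumes "comm_ring_hom h" "\<And>e. e \<in> E \<Longrightarrow> h (u e) = 0" "P \<in> topes L" "Q \<in> topes L"
  shows "h (sep_prod u P Q) = (if P = Q then 1 else 0)"
proof -
  interpret h: comm_ring_hom h by fact
  have "h (sep_prod u P Q) = sep_prod (\<lambda>e. h (u e)) P Q"
    by (simp add: sep_prod_def h.hom_prod)
  then show ?thesis using sep_prod_vanishing[OF assms(3,4), of "\<lambda>e. h (u e)"] assms(2) by simp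
qed

lemma hom_kdet_sep_prod:
  assumes "comm_ring_hom h" "\<And>e. e \<in> E \<Longrightarrow> h (u e) = 0" "distinct ys" "set ys \<subseteq> topes L"
  shows "h (kdet ys (sep_prod u)) = 1"
proof -
  interpret h: comm_ring_hom h by fact
  have "h (kdet ys (sep_prod u)) = kdet ys (\<lambda>P Q. h (sep_prod u P Q))"
    by (rule h.hom_kdet)
  also have "\<dots> = kdet ys (\<lambda>P Q. if P = Q then 1 else 0)"
    using hom_sep_prod[where u = u, OF assms(1,2)] assms(4) by (intro kdet_cong) (simp add: subset_iff)
  also have "\<dots> = (\<Prod>P\<in>set ys. if P = P then 1 else 0)"
    by (rule kdet_block_triangular[OF assms(3), where S = UNIV]) (auto split: if_splits)
  finally show ?thesis by simp
qed

text \<open>Cramer's rule for the submatrix of topes above \<open>F\<close> handles the rows above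
  \<open>F\<close>; for any other row \<open>P\<close> the gate property reduces to the row of
  \<open>compose F P\<close>.\<close>

lemma column_combination_at_face:
  assumes "F \<in> L" "D \<in> topes L" "F \<le> D" "distinct xs" "set xs = topes L"
  obtains x where "\<And>R. x R \<noteq> 0 \<Longrightarrow> F \<le> R"
    "\<And>P. P \<in> topes L \<Longrightarrow> (\<Sum>R\<in>topes L. sep_prod u P R * x R) =
      (if compose F P = D then kdet (filter (\<lambda>R. F \<le> R) xs) (sep_prod u) * sep_prod u P D else 0)"
proof -
  let ?ys = "filter (\<lambda>R. F \<le> R) xs"
  have ys: "distinct ?ys" "set ?ys = {R \<in> topes L. F \<le> R}" using assms by auto
  then have D: "D \<in> set ?ys" using assms by simp
  obtain x where x: "\<And>P. P \<in> set ?ys \<Longrightarrow> (\<Sum>R\<in>set ?ys. sep_prod u P R * x R) =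
      (if P = D then kdet ?ys (sep_prod u) else 0)"
    using kdet_adjugate[where f = "sep_prod u", OF ys(1) D] by blast
  define x' where "x' R = (if F \<le> R then x R else 0)" for R
  show thesis
  proof (rule that)
    show "F \<le> R" if "x' R \<noteq> 0" for R using that by (auto simp: x'_def split: if_splits)
    fix P assume P: "P \<in> topes L"
    have FP: "compose F P \<in> set ?ys" using compose_tope[OF assms(1) P] compose_ge ys(2) by auto
    have "(\<Sum>R\<in>topes L. sep_prod u P R * x' R) = (\<Sum>R\<in>set ?ys. sep_prod u P R * x R)"
      unfolding ys(2) using finite_topes
      by (simp only: sum.inter_filter) (auto simp: x'_def intro!: sum.cong)
    also have "\<dots> = (\<Sum>R\<in>set ?ys. sep_prod u P (compose F P) * (sep_prod u (compose F P) R * x R))"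
    proof (rule sum.cong[OF refl])
      fix R assume "R \<in> set ?ys"
      then have "R \<in> topes L" "F \<le> R" using ys(2) by auto
      then show "sep_prod u P R * x R = sep_prod u P (compose F P) * (sep_prod u (compose F P) R * x R)"
        by (subst sep_prod_gate[OF assms(1) P]) (auto simp: mult.assoc)
    qed
    also have "\<dots> = sep_prod u P (compose F P) * (if compose F P = D then kdet ?ys (sep_prod u) else 0)"
      by (simp only: x[OF FP] sum_distrib_left[symmetric])
    finally show "(\<Sum>R\<in>topes L. sep_prod u P R * x' R) =
      (if compose F P = D then kdet ?ys (sep_prod u) * sep_prod u P D else 0)"
      by (auto simp: mult.commute)
  qed
qed

lemma sum_faces_strictly_above:
  assumes "D \<in> topes L" "P \<in> topes L" "F0 \<in> L" "F0 \<le> D"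
  shows "(\<Sum>F | F \<in> L \<and> F0 \<le> F \<and> F \<le> D \<and> F \<noteq> F0. if compose F P = D then sg (z F) else 0) =
    (if compose F0 P = compose F0 (- D) then 1 else 0) - (if compose F0 P = D then sg (z F0) else 0)"
proof -
  let ?S = "{F. F \<in> L \<and> F0 \<le> F \<and> F \<le> D}"
  let ?g = "\<lambda>F. if compose F P = D then sg (z F) else 0"
  have fin: "finite ?S" using finite_covectors by simp
  have "(\<Sum>F\<in>?S. ?g F) = (\<Sum>F | F \<in> L \<and> F0 \<le> F \<and> F \<le> D \<and> compose F P = D. sg (z F))"
    unfolding sum.inter_filter[OF fin, symmetric] by (rule sum.cong) auto
  also have "\<dots> = (if compose F0 P = compose F0 (- D) then 1 else 0)"
    using sum_faces_of_tope assms by blast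
  finally have "(\<Sum>F\<in>?S - {F0}. ?g F) = (if compose F0 P = compose F0 (- D) then 1 else 0) - ?g F0"
    using fin assms by (simp add: sum_diff1)
  moreover have "{F. F \<in> L \<and> F0 \<le> F \<and> F \<le> D \<and> F \<noteq> F0} = ?S - {F0}" by blast
  ultimately show ?thesis by simp
qed

text \<open>
  Writing \<open>v\<close> for the Varchenko matrix and \<open>v'\<close> for its specialisation, a matrix \<open>X\<close> is
  constructed such that \<open>v X = W f\<close> and \<open>v' X = W\<close>, where \<open>f\<close> couples each tope \<open>D\<close> only to the
  tope \<open>\<iota> D\<close> opposite to it around the face \<open>face e D\<close>.
\<close>

lemma kdet_sep_prod_update:
  fixes u :: "'a \<Rightarrow> 'r :: idom" and h :: "'r \<Rightarrow> int"
  assumes h: "comm_ring_hom h" "\<And>e. e \<in> E \<Longrightarrow> h (u e) = 0"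
    and xs: "distinct xs" "set xs = topes L"
    and e: "e \<in> E"
  shows "kdet xs (sep_prod u) = kdet xs (sep_prod (u(e := 0))) *
    (\<Prod>D | D \<in> topes L \<and> D e = Pos. 1 - (\<Prod>i\<in>z (face e D). (u i)\<^sup>2))"
proof -
  interpret h: comm_ring_hom h by fact
  let ?T = "topes L" and ?F = "face e"
  let ?v = "sep_prod u" and ?v' = "sep_prod (u(e := 0))"
  define d where "d F = kdet (filter (\<lambda>R. F \<le> R) xs) ?v" for F
  \<comment> \<open>Different faces produce different factors \<open>d F\<close>. Multiplying them
    all together allows every combination to be scaled to the same factor, and \<open>h\<close> maps
    it to one.\<close>
  define \<delta> where "\<delta> = (\<Prod>F\<in>L. d F)"
  have "h (d F) = 1" for F
    unfolding d_def using hom_kdet_sep_prod[where u = u and ys = "filter (\<lambda>R. F \<le> R) xs", OF h] xs by auto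
  then have h\<delta>: "h \<delta> = 1" by (simp add: \<delta>_def h.hom_prod)
  define good where "good F D x \<longleftrightarrow> (\<forall>R. x R \<noteq> 0 \<longrightarrow> F \<le> R) \<and>
    (\<forall>P\<in>?T. (\<Sum>R\<in>?T. ?v P R * x R) = (if compose F P = D then \<delta> * ?v P D else 0))" for F D x
  have good: "\<exists>x. good F D x" if FD: "F \<in> L" "D \<in> ?T" "F \<le> D" for F D
  proof -
    obtain x where x: "\<And>R. x R \<noteq> 0 \<Longrightarrow> F \<le> R" "\<And>P. P \<in> ?T \<Longrightarrow>
        (\<Sum>R\<in>?T. ?v P R * x R) = (if compose F P = D then d F * ?v P D else 0)"
      using column_combination_at_face[where u = u, OF FD xs, folded d_def] by blast
    define c where "c = (\<Prod>G\<in>L - {F}. d G)"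
    have \<delta>: "\<delta> = c * d F"
      unfolding \<delta>_def c_def using FD(1) finite_covectors by (simp add: prod.remove mult.commute)
    have "(\<Sum>R\<in>?T. ?v P R * (c * x R)) = (if compose F P = D then \<delta> * ?v P D else 0)" if "P \<in> ?T" for P
    proof -
      have "(\<Sum>R\<in>?T. ?v P R * (c * x R)) = c * (\<Sum>R\<in>?T. ?v P R * x R)"
        by (simp add: sum_distrib_left mult.left_commute)
      then show ?thesis using x(2)[OF that] by (simp add: \<delta> mult.assoc)
    qed
    then have "good F D (\<lambda>R. c * x R)" using x(1) by (auto simp: good_def)
    then show ?thesis by blast
  qed
  define x where "x F D = (SOME y. good F D y)" for F D
  have "good F D (x F D)" if "F \<in> L" "D \<in> ?T" "F \<le> D" for F D
    unfolding x_def using someI_ex[OF good[OF that]] .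
  then have x: "\<And>F D R. F \<in> L \<Longrightarrow> D \<in> ?T \<Longrightarrow> F \<le> D \<Longrightarrow> x F D R \<noteq> 0 \<Longrightarrow> F \<le> R"
    "\<And>F D P. F \<in> L \<Longrightarrow> D \<in> ?T \<Longrightarrow> F \<le> D \<Longrightarrow> P \<in> ?T \<Longrightarrow>
      (\<Sum>R\<in>?T. ?v P R * x F D R) = (if compose F P = D then \<delta> * ?v P D else 0)"
    unfolding good_def by blast+
  \<comment> \<open>The faces strictly between the hyperplane face and \<open>D\<close>. None of
    them has zero entry at \<open>e\<close>, so column \<open>D\<close> of \<open>X\<close> is
    supported on topes on the side of \<open>D\<close>.\<close>
  define above where "above D = {F. F \<in> L \<and> ?F D \<le> F \<and> F \<le> D \<and> F \<noteq> ?F D}" for D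
  define X where "X R D = (\<Sum>F\<in>above D. of_int (sg (z (?F D)) * sg (z F)) * x F D R)" for R D
  define \<iota> where "\<iota> D = compose (?F D) (- D)" for D
  define Y where "Y P D = (if compose (?F D) P = D then ?v P D else 0)" for P D
  define c where "c D = - (of_int (sg (z (?F D))) * (\<Prod>i\<in>z (?F D). u i))" for D
  let ?W = "\<lambda>P D. - \<delta> * Y P D"
  let ?f = "\<lambda>P D. (if P = D then 1 else 0) + (if P = \<iota> D then c D else 0)"
  have \<iota>: "\<iota> D \<in> ?T" "?F (\<iota> D) = ?F D" "\<iota> (\<iota> D) = D" "\<iota> D e = - D e" if "D \<in> ?T" for D
    using antipode_face[OF that refl] e by (simp_all add: \<iota>_def)
  have vX: "(\<Sum>R\<in>?T. ?v P R * X R D) = \<delta> * ?v P D *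
      ((if compose (?F D) P = \<iota> D then of_int (sg (z (?F D))) else 0) -
       (if compose (?F D) P = D then 1 else 0))" if P: "P \<in> ?T" and D: "D \<in> ?T" for P D
  proof -
    have "(\<Sum>R\<in>?T. ?v P R * X R D) =
        (\<Sum>R\<in>?T. \<Sum>F\<in>above D. of_int (sg (z (?F D)) * sg (z F)) * (?v P R * x F D R))"
      unfolding X_def by (simp add: sum_distrib_left mult.left_commute)
    also have "\<dots> = (\<Sum>F\<in>above D. of_int (sg (z (?F D)) * sg (z F)) * (\<Sum>R\<in>?T. ?v P R * x F D R))"
      by (subst sum.swap) (simp add: sum_distrib_left)
    also have "\<dots> = (\<Sum>F\<in>above D. \<delta> * ?v P D *
        of_int (sg (z (?F D)) * (if compose F P = D then sg (z F) else 0)))"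
      using x(2) P D by (intro sum.cong) (auto simp: above_def)
    also have "\<dots> = \<delta> * ?v P D * of_int (sg (z (?F D)) *
        (\<Sum>F\<in>above D. if compose F P = D then sg (z F) else 0))"
      by (simp only: sum_distrib_left of_int_sum)
    also have "(\<Sum>F\<in>above D. if compose F P = D then sg (z F) else 0) =
        (if compose (?F D) P = \<iota> D then 1 else 0) - (if compose (?F D) P = D then sg (z (?F D)) else 0)"
      unfolding above_def \<iota>_def using sum_faces_strictly_above[OF D P face_in face_le] .
    finally show ?thesis by (simp add: right_diff_distrib flip: of_int_mult)
  qed
  have "kdet xs ?v * kdet xs X = kdet xs (\<lambda>P D. \<Sum>R\<in>?T. ?v P R * X R D)"
    using kdet_mult[OF xs(1), of ?v X] xs(2) by simp
  also have "\<dots> = kdet xs (\<lambda>P D. \<Sum>R\<in>?T. ?W P R * ?f R D)"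
  proof (rule kdet_cong)
    fix P D assume "P \<in> set xs" "D \<in> set xs"
    then have P: "P \<in> ?T" and D: "D \<in> ?T" using xs by auto
    note F = face_in[of e D] face_le[of e D]
    have "\<iota> D \<noteq> D" using \<iota>(4)[OF D] tope_nonzero[OF D e] by auto
    have "(\<Sum>R\<in>?T. ?W P R * ?f R D) =
        (\<Sum>R\<in>?T. if R = D then ?W P R else 0) + (\<Sum>R\<in>?T. if R = \<iota> D then ?W P R * c D else 0)"
      unfolding sum.distrib[symmetric] by (rule sum.cong) (auto simp: distrib_left)
    also have "\<dots> = - \<delta> * (Y P D + Y P (\<iota> D) * c D)"
      using finite_topes D \<iota>(1)[OF D] by (simp add: distrib_left mult.assoc)
    also have "Y P (\<iota> D) * c D =
        (if compose (?F D) P = \<iota> D then - (of_int (sg (z (?F D))) * ?v P D) else 0)"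
    proof (cases "compose (?F D) P = \<iota> D")
      \<comment> \<open>Around the face of \<open>D\<close>, the row of \<open>P\<close> has its
        gate at \<open>\<iota> D\<close>, and passing from there to \<open>D\<close> crosses exactly
        the zero set of that face.\<close>
      case True
      have "?v P D = ?v P (\<iota> D) * (\<Prod>i\<in>z (?F D). u i)"
        using sep_prod_gate[OF F(1) P D F(2), of u] sep_prod_antipode[OF D F, of u] True
        by (simp add: \<iota>_def)
      then show ?thesis using True \<iota>(2)[OF D] by (simp add: Y_def c_def mult.left_commute)
    qed (simp add: Y_def \<iota>(2)[OF D])
    also have "- \<delta> * (Y P D + \<dots>) = (\<Sum>R\<in>?T. ?v P R * X R D)"
      unfolding vX[OF P D] by (simp add: Y_def algebra_simps)
    finally show "(\<Sum>R\<in>?T. ?v P R * X R D) = (\<Sum>R\<in>?T. ?W P R * ?f R D)" ..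
  qed
  also have "\<dots> = kdet xs ?W * kdet xs ?f"
    using kdet_mult[OF xs(1), of ?W ?f] xs(2) by simp
  finally have eq1: "kdet xs ?v * kdet xs X = kdet xs ?W * kdet xs ?f" .
  have "kdet xs ?v' * kdet xs X = kdet xs (\<lambda>P D. \<Sum>R\<in>?T. ?v' P R * X R D)"
    using kdet_mult[OF xs(1), of ?v' X] xs(2) by simp
  also have "\<dots> = kdet xs ?W"
  proof (rule kdet_cong)
    fix P D assume "P \<in> set xs" "D \<in> set xs"
    then have P: "P \<in> ?T" and D: "D \<in> ?T" using xs by auto
    \<comment> \<open>A face in \<open>above D\<close> with zero entry at \<open>e\<close> would lie
      below the greatest such face, against the choice of \<open>above\<close>.\<close>
    have same_side: "R e = D e" if X: "X R D \<noteq> 0" for R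
    proof -
      obtain F where F: "F \<in> above D" "x F D R \<noteq> 0"
        using X unfolding X_def by (auto elim!: sum.not_neutral_contains_not_neutral)
      then have "F \<le> R" using x(1)[OF _ D] by (auto simp: above_def)
      moreover have "F e \<noteq> Zero"
        using F(1) face_greatest[of F D e] by (auto simp: above_def)
      moreover have "F \<le> D" using F(1) by (simp add: above_def)
      ultimately show ?thesis by (metis sign_vector_le_iff)
    qed
    have "(\<Sum>R\<in>?T. ?v' P R * X R D) = (\<Sum>R\<in>?T. if P e = D e then ?v P R * X R D else 0)"
      using same_side sep_prod_update[OF P _ e, of _ u] by (intro sum.cong) force+
    also have "\<dots> = (if P e = D e then \<Sum>R\<in>?T. ?v P R * X R D else 0)" by simp
    also have "\<dots> = ?W P D"
    proof -
      \<comment> \<open>The hyperplane face does not change the side of \<open>P\<close>. So on the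
        side of \<open>D\<close> the term with \<open>\<iota> D\<close> disappears, and on the other
        side \<open>Y P D\<close> is zero.\<close>
      have "compose (?F D) P e = P e" by (simp add: compose_apply face_apply)
      then have "P e = D e \<Longrightarrow> compose (?F D) P \<noteq> \<iota> D" "P e \<noteq> D e \<Longrightarrow> compose (?F D) P \<noteq> D"
        using \<iota>(4)[OF D] tope_nonzero[OF D e] by auto
      then show ?thesis using vX[OF P D] by (auto simp: Y_def)
    qed
    finally show "(\<Sum>R\<in>?T. ?v' P R * X R D) = ?W P D" .
  qed
  finally have eq2: "kdet xs ?v' * kdet xs X = kdet xs ?W" .
  \<comment> \<open>Under \<open>h\<close> the matrix \<open>?W\<close> becomes minus the identity,
    so its determinant is nonzero. Then so is that of \<open>X\<close>, which can be cancelled in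
    the integral domain.\<close>
  have "h (kdet xs ?W) = kdet xs (\<lambda>P D. h (?W P D))" by (rule h.hom_kdet)
  also have "\<dots> = kdet xs (\<lambda>P D. if P = D then - 1 else 0)"
  proof (rule kdet_cong)
    fix P D assume "P \<in> set xs" "D \<in> set xs"
    then have P: "P \<in> ?T" and D: "D \<in> ?T" using xs by auto
    have "compose (?F D) D = D"
      using face_le[of e D] by (auto simp: compose_def fun_eq_iff sign_vector_le_iff)
    then show "h (?W P D) = (if P = D then - 1 else 0)"
      using hom_sep_prod[where u = u, OF h P D] h\<delta> by (auto simp: Y_def h.hom_mult h.hom_uminus)
  qed
  also have "\<dots> = (\<Prod>P\<in>set xs. if P = P then - 1 else 0)"
    by (rule kdet_block_triangular[OF xs(1), where S = UNIV]) (auto split: if_splits)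
  finally have "kdet xs ?W \<noteq> 0" by auto
  then have "kdet xs X \<noteq> 0" using eq2 by auto
  have "kdet xs ?v * kdet xs X = (kdet xs ?v' * kdet xs ?f) * kdet xs X"
    using eq1 eq2 by (simp add: mult_ac)
  then have "kdet xs ?v = kdet xs ?v' * kdet xs ?f" using \<open>kdet xs X \<noteq> 0\<close> by simp
  also have "kdet xs ?f = (\<Prod>D | D \<in> set xs \<and> D \<in> {D. D e = Pos}. 1 - c D * c (\<iota> D))"
  proof (rule kdet_involution[OF xs(1)])
    fix D assume "D \<in> set xs"
    then have D: "D \<in> ?T" using xs by simp
    then show "\<iota> D \<in> set xs \<and> \<iota> (\<iota> D) = D \<and> (\<iota> D \<in> {D. D e = Pos} \<longleftrightarrow> D \<notin> {D. D e = Pos})"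
      using \<iota>[OF D] tope_nonzero[OF D e] xs by (cases "D e") auto
  qed
  also have "\<dots> = (\<Prod>D | D \<in> ?T \<and> D e = Pos. 1 - (\<Prod>i\<in>z (?F D). (u i)\<^sup>2))"
  proof (rule prod.cong)
    fix D assume "D \<in> {D \<in> ?T. D e = Pos}"
    then have "?F (\<iota> D) = ?F D" using \<iota> by blast
    then have "c D * c (\<iota> D) = (of_int (sg (z (?F D))) * of_int (sg (z (?F D)))) * (\<Prod>i\<in>z (?F D). u i)\<^sup>2"
      by (simp only: c_def power2_eq_square minus_mult_minus mult_ac)
    moreover have "of_int (sg (z (?F D))) * of_int (sg (z (?F D))) = (1 :: 'r)"
      by (simp flip: of_int_mult)
    ultimately show "1 - c D * c (\<iota> D) = 1 - (\<Prod>i\<in>z (?F D). (u i)\<^sup>2)"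
      by (simp add: prod_power_distrib)
  qed (use xs in auto)
  finally show ?thesis .
qed

text \<open>For \<open>A = {}\<close> the base of the factor is zero, so this vanishing exponent is
  what makes the factor equal to one.\<close>

lemma flat_multiplicity_empty: "flat_multiplicity E L {} = 0"
proof -
  have "matroid_rank (Mat {} (restriction L {})) {} = 0"
    by (simp add: matroid_rank_restriction matroid.matroid_rank_empty)
  then show ?thesis by (simp add: flat_multiplicity_def crapo_beta_def)
qed

text \<open>Topes on the positive side are grouped by their hyperplane face: the possible faces are
  the topes of the contraction, and each occurs beta many times. In particular the count is the same
  for every \<open>e\<close> in \<open>A\<close>.\<close>

lemma flat_multiplicity_eq_card:
  assumes "A \<in> flats (Mat E L)" "e \<in> A"
  shows "flat_multiplicity E L A = int (card {D \<in> topes L. D e = Pos \<and> z (face e D) = A})"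
proof -
  let ?S = "{D \<in> topes L. D e = Pos \<and> z (face e D) = A}" and ?T = "{F \<in> L. z F = A}"
  have fin: "finite ?S" "finite ?T" using finite_topes finite_covectors by auto
  have "int (card ?S) = (\<Sum>D\<in>?S. 1)" by simp
  also have "\<dots> = (\<Sum>F\<in>?T. \<Sum>D | D \<in> ?S \<and> face e D = F. 1)"
    using fin face_in by (intro sum.group[symmetric]) auto
  also have "\<dots> = (\<Sum>F\<in>?T. crapo_beta (Mat A (restriction L A)))"
  proof (rule sum.cong[OF refl])
    fix F assume F: "F \<in> ?T"
    then have "{D. D \<in> ?S \<and> face e D = F} = {D \<in> topes L. D e = Pos \<and> face e D = F}" by auto
    then show "(\<Sum>D | D \<in> ?S \<and> face e D = F. 1) = crapo_beta (Mat A (restriction L A))"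
      using card_topes_with_face[of F e] F assms(2) by auto
  qed
  also have "\<dots> = flat_multiplicity E L A"
    using topes_contraction[OF assms(1)] by (simp add: flat_multiplicity_def)
  finally show ?thesis ..
qed

text \<open>The multiplicity is a cardinality or zero, so \<open>nat\<close> in the exponents loses
  nothing.\<close>

lemma flat_multiplicity_nonneg:
  assumes "A \<in> flats (Mat E L)"
  shows "0 \<le> flat_multiplicity E L A"
  using flat_multiplicity_eq_card[OF assms] flat_multiplicity_empty by (cases "A = {}") fastforce+

text \<open>Expresses the multiplicity through the ground set and the flats, which is why the
  determinant depends on the matroid only.\<close>

lemma flat_multiplicity_eq:
  assumes "A \<in> flats (Mat E L)"
  shows "flat_multiplicity E L A =
    (let r = matroid_rank (Mat E L) in
      (- 1) ^ r A * (\<Sum>B | A \<subseteq> B \<and> B \<subseteq> E. (- 1) ^ card (B - A) * (- 1) ^ r B) *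
      crapo_beta \<lparr>ground = A, flats = (\<lambda>B. B \<inter> A) ` flats (Mat E L)\<rparr>)"
proof -
  have A: "A \<subseteq> E" using assms zero_set_subset by (auto simp: flats_Mat)
  have "Mat A (restriction L A) = \<lparr>ground = A, flats = (\<lambda>B. B \<inter> A) ` flats (Mat E L)\<rparr>"
    using flats_restriction[OF A] by (simp add: Mat_def)
  then show ?thesis
    using card_zero_set_eq[OF A] topes_contraction[OF assms]
    by (simp add: flat_multiplicity_def Let_def sg_def)
qed

text \<open>Induction on the number of nonzero weights. At \<open>u e = 0\<close> every flat
  containing \<open>e\<close> has factor one; restoring \<open>u e\<close> supplies these factors
  and leaves the other flats unchanged.\<close>

lemma kdet_sep_prod:
  fixes u :: "'a \<Rightarrow> 'r :: idom" and h :: "'r \<Rightarrow> int"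
  assumes h: "comm_ring_hom h" "\<And>e. e \<in> E \<Longrightarrow> h (u e) = 0"
    and xs: "distinct xs" "set xs = topes L"
  shows "kdet xs (sep_prod u) =
    (\<Prod>A\<in>flats (Mat E L). (1 - (\<Prod>e\<in>A. (u e)\<^sup>2)) ^ nat (flat_multiplicity E L A))"
  using h(2)
proof (induction "card {e \<in> E. u e \<noteq> 0}" arbitrary: u rule: less_induct)
  case less
  interpret h: comm_ring_hom h by fact
  let ?m = "\<lambda>A. nat (flat_multiplicity E L A)"
  have finF: "finite (flats (Mat E L))" using finite_covectors by (simp add: flats_Mat)
  have finA: "finite A" if "A \<in> flats (Mat E L)" for A using that by (auto simp: flats_Mat)
  have vanish: "(\<Prod>i\<in>A. (w i)\<^sup>2) = 0" if "A \<in> flats (Mat E L)" "e \<in> A" "w e = 0"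
    for A e and w :: "'a \<Rightarrow> 'r"
    using finA that by (intro prod_zero) auto
  show ?case
  proof (cases "\<exists>e\<in>E. u e \<noteq> 0")
    case False
    have "kdet xs (sep_prod u) = kdet xs (\<lambda>P Q. if P = Q then 1 else 0)"
      using False xs(2) by (intro kdet_cong sep_prod_vanishing) auto
    also have "\<dots> = (\<Prod>P\<in>set xs. if P = P then 1 else 0)"
      by (rule kdet_block_triangular[OF xs(1), where S = UNIV]) (auto split: if_splits)
    finally have "kdet xs (sep_prod u) = 1" by simp
    moreover have "(1 - (\<Prod>e\<in>A. (u e)\<^sup>2)) ^ ?m A = 1" if A: "A \<in> flats (Mat E L)" for A
    proof (cases "A = {}")
      case True
      then show ?thesis by (simp add: flat_multiplicity_empty)
    next
      case nonempty: False
      then obtain e where "e \<in> A" by blast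
      moreover from this have "e \<in> E" using A by (auto simp: flats_Mat)
      ultimately show ?thesis using vanish[OF A, of e u] False by simp
    qed
    ultimately show ?thesis by simp
  next
    case True
    then obtain e where e: "e \<in> E" "u e \<noteq> 0" by blast
    let ?u = "u(e := 0)"
    let ?g = "\<lambda>A. 1 - (\<Prod>i\<in>A. (u i)\<^sup>2)"
    have "{i \<in> E. ?u i \<noteq> 0} \<subset> {i \<in> E. u i \<noteq> 0}" using e by auto
    then have "card {i \<in> E. ?u i \<noteq> 0} < card {i \<in> E. u i \<noteq> 0}"
      using finite_ground by (intro psubset_card_mono) auto
    then have IH: "kdet xs (sep_prod ?u) =
        (\<Prod>A\<in>flats (Mat E L). (1 - (\<Prod>i\<in>A. (?u i)\<^sup>2)) ^ ?m A)"
      by (rule less.hyps) (use less.prems in auto)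
    \<comment> \<open>The correction factor is regrouped by the zero set of the hyperplane face, a
      flat containing \<open>e\<close>.\<close>
    have "(\<Prod>D | D \<in> topes L \<and> D e = Pos. ?g (z (face e D))) =
        (\<Prod>A | A \<in> flats (Mat E L) \<and> e \<in> A. \<Prod>D | D \<in> {D. D \<in> topes L \<and> D e = Pos} \<and> z (face e D) = A.
          ?g (z (face e D)))"
      using finite_topes finF face_in face_apply e(1)
      by (intro prod.group[symmetric]) (auto simp: flats_Mat)
    also have "\<dots> = (\<Prod>A | A \<in> flats (Mat E L) \<and> e \<in> A. ?g A ^ ?m A)"
    proof (rule prod.cong[OF refl])
      fix A assume A: "A \<in> {A. A \<in> flats (Mat E L) \<and> e \<in> A}"
      then have "?m A = card {D \<in> topes L. D e = Pos \<and> z (face e D) = A}"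
        using flat_multiplicity_eq_card[of A e] by simp
      then show "(\<Prod>D | D \<in> {D. D \<in> topes L \<and> D e = Pos} \<and> z (face e D) = A. ?g (z (face e D))) =
        ?g A ^ ?m A"
        by (simp add: conj_assoc)
    qed
    also have "\<dots> = (\<Prod>A\<in>flats (Mat E L). if e \<in> A then ?g A ^ ?m A else 1)"
      using finF by (simp only: prod.inter_filter)
    finally have "kdet xs (sep_prod u) = (\<Prod>A\<in>flats (Mat E L). (1 - (\<Prod>i\<in>A. (?u i)\<^sup>2)) ^ ?m A) *
        (\<Prod>A\<in>flats (Mat E L). if e \<in> A then ?g A ^ ?m A else 1)"
      using kdet_sep_prod_update[OF h(1) less.prems xs e(1)] IH by simp
    also have "\<dots> = (\<Prod>A\<in>flats (Mat E L). ?g A ^ ?m A)"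
      unfolding prod.distrib[symmetric]
    proof (rule prod.cong[OF refl])
      fix A assume A: "A \<in> flats (Mat E L)"
      show "(1 - (\<Prod>i\<in>A. (?u i)\<^sup>2)) ^ ?m A * (if e \<in> A then ?g A ^ ?m A else 1) = ?g A ^ ?m A"
      proof (cases "e \<in> A")
        case True
        then show ?thesis using vanish[OF A, of e ?u] by simp
      next
        case False
        then have "(\<Prod>i\<in>A. (?u i)\<^sup>2) = (\<Prod>i\<in>A. (u i)\<^sup>2)" by (intro prod.cong) auto
        then show ?thesis using False by simp
      qed
    qed
    finally show ?thesis .
  qed
qed

end

text \<open>
  The ring of polynomials over \<open>'e\<close> is an instance of \<^class>\<open>idom\<close> only for linearly ordered
  index types. The formula is therefore proved for integer polynomials in variables indexed
  by numbers and transported along the evaluation homomorphism.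
\<close>

definition monomial_value :: "(nat \<Rightarrow> 'a :: comm_ring_1) \<Rightarrow> (nat \<Rightarrow>\<^sub>0 nat) \<Rightarrow> 'a" where
  "monomial_value a m = (\<Prod>i\<in>Poly_Mapping.keys m. a i ^ Poly_Mapping.lookup m i)"

definition poly_value :: "(nat \<Rightarrow> 'a :: comm_ring_1) \<Rightarrow> ((nat \<Rightarrow>\<^sub>0 nat) \<Rightarrow>\<^sub>0 int) \<Rightarrow> 'a" where
  "poly_value a p = (\<Sum>m\<in>Poly_Mapping.keys p. of_int (Poly_Mapping.lookup p m) * monomial_value a m)"

lemma monomial_value_superset:
  assumes "finite S" "Poly_Mapping.keys m \<subseteq> S"
  shows "monomial_value a m = (\<Prod>i\<in>S. a i ^ Poly_Mapping.lookup m i)"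
  unfolding monomial_value_def using assms by (intro prod.mono_neutral_left) (auto simp: in_keys_iff)

lemma monomial_value_zero: "monomial_value a 0 = 1"
  by (simp add: monomial_value_def)

lemma monomial_value_add: "monomial_value a (m + n) = monomial_value a m * monomial_value a n"
proof -
  let ?S = "Poly_Mapping.keys m \<union> Poly_Mapping.keys n"
  have "monomial_value a k = (\<Prod>i\<in>?S. a i ^ Poly_Mapping.lookup k i)" if "Poly_Mapping.keys k \<subseteq> ?S" for k
    using that by (intro monomial_value_superset) auto
  then show ?thesis
    using Poly_Mapping.keys_add[of m n] by (simp add: lookup_add power_add prod.distrib)
qed

lemma poly_value_superset:
  assumes "finite S" "Poly_Mapping.keys p \<subseteq> S"
  shows "poly_value a p = (\<Sum>m\<in>S. of_int (Poly_Mapping.lookup p m) * monomial_value a m)"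
  unfolding poly_value_def using assms by (intro sum.mono_neutral_left) (auto simp: in_keys_iff)

lemma poly_value_add: "poly_value a (p + q) = poly_value a p + poly_value a q"
proof -
  let ?S = "Poly_Mapping.keys p \<union> Poly_Mapping.keys q"
  have "poly_value a r = (\<Sum>m\<in>?S. of_int (Poly_Mapping.lookup r m) * monomial_value a m)"
    if "Poly_Mapping.keys r \<subseteq> ?S" for r
    using that by (intro poly_value_superset) auto
  then show ?thesis
    using Poly_Mapping.keys_add[of p q] by (simp add: lookup_add distrib_right sum.distrib)
qed

lemma poly_value_zero: "poly_value a 0 = 0"
  by (simp add: poly_value_def)

lemma poly_value_sum: "poly_value a (sum f S) = (\<Sum>s\<in>S. poly_value a (f s))"
  by (induction S rule: infinite_finite_induct) (simp_all add: poly_value_add poly_value_zero)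

lemma poly_value_single: "poly_value a (Poly_Mapping.single m c) = of_int c * monomial_value a m"
  by (cases "c = 0") (simp_all add: poly_value_def)

lemma poly_mapping_sum_single: "p = (\<Sum>m\<in>Poly_Mapping.keys p. Poly_Mapping.single m (Poly_Mapping.lookup p m))"
  by (rule poly_mapping_eqI) (simp add: lookup_sum lookup_single when_def in_keys_iff)

lemma poly_value_mult: "poly_value a (p * q) = poly_value a p * poly_value a q"
proof -
  let ?s = "\<lambda>p m. Poly_Mapping.single m (Poly_Mapping.lookup p m)"
  let ?K = "Poly_Mapping.keys p" and ?K' = "Poly_Mapping.keys q"
  have "p * q = (\<Sum>m\<in>?K. ?s p m) * (\<Sum>n\<in>?K'. ?s q n)"
    using poly_mapping_sum_single[of p] poly_mapping_sum_single[of q] by simp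
  also have "\<dots> = (\<Sum>m\<in>?K. \<Sum>n\<in>?K'. ?s p m * ?s q n)" by (rule sum_product)
  finally have "poly_value a (p * q) = (\<Sum>m\<in>?K. \<Sum>n\<in>?K'. poly_value a (?s p m * ?s q n))"
    by (simp add: poly_value_sum)
  also have "\<dots> = (\<Sum>m\<in>?K. \<Sum>n\<in>?K'. (of_int (Poly_Mapping.lookup p m) * monomial_value a m) *
      (of_int (Poly_Mapping.lookup q n) * monomial_value a n))"
    by (simp add: mult_single poly_value_single monomial_value_add mult_ac)
  also have "\<dots> = poly_value a p * poly_value a q"
    unfolding poly_value_def by (rule sum_product[symmetric])
  finally show ?thesis .
qed

lemma comm_ring_hom_poly_value: "comm_ring_hom (poly_value a)"
proof
  show "poly_value a 1 = 1"
    using poly_value_single[of a 0 1] by (simp add: monomial_value_zero)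
qed (simp_all add: poly_value_add poly_value_mult poly_value_zero)

lemma poly_value_variable: "poly_value a (Poly_Mapping.single (Poly_Mapping.single i 1) 1) = a i"
  by (simp add: poly_value_single monomial_value_def)

lemma det_varchenko_matrix:
  fixes E :: "'e set"
  assumes "loopless_oriented_matroid E L" "distinct Ps" "set Ps = topes L"
  shows "det (varchenko_matrix Ps :: ('e, 'k :: field) mpoly mat) =
    (\<Prod>A \<in> flats (Mat E L). (1 - (\<Prod>e\<in>A. (U e)\<^sup>2)) ^ nat (flat_multiplicity E L A))"
proof -
  interpret loopless_oriented_matroid E L by fact
  obtain k :: "'e \<Rightarrow> nat" where "bij_betw k E {0..<card E}"
    using ex_bij_betw_finite_nat[OF finite_ground] by blast
  then have inj: "inj_on k E" by (rule bij_betw_imp_inj_on)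
  define X :: "'e \<Rightarrow> (nat \<Rightarrow>\<^sub>0 nat) \<Rightarrow>\<^sub>0 int"
    where "X e = Poly_Mapping.single (Poly_Mapping.single (k e) 1) 1" for e
  \<comment> \<open>Only indices \<open>k e\<close> with \<open>e \<in> E\<close> matter, and there
    \<open>inv_into E k\<close> recovers \<open>e\<close>.\<close>
  define a :: "nat \<Rightarrow> ('e, 'k) mpoly" where "a i = U (inv_into E k i)" for i
  interpret ev: comm_ring_hom "poly_value a" by (rule comm_ring_hom_poly_value)
  have ev_X: "poly_value a (X e) = U e" if "e \<in> E" for e
    using that inj by (simp add: X_def a_def poly_value_variable del: One_nat_def)
  have "det (varchenko_matrix Ps :: ('e, 'k) mpoly mat) = kdet Ps (sep_prod U)"
    by (simp add: kdet_def kernel_mat_def varchenko_matrix_def sep_prod_def)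
  also have "\<dots> = kdet Ps (\<lambda>P Q. poly_value a (sep_prod X P Q))"
  proof (rule kdet_cong)
    fix P Q assume "P \<in> set Ps" "Q \<in> set Ps"
    then have "Sep P Q \<subseteq> E" using Sep_topes assms(3) by blast
    then show "sep_prod U P Q = poly_value a (sep_prod X P Q)"
      unfolding sep_prod_def ev.hom_prod by (intro prod.cong) (auto simp: ev_X)
  qed
  also have "\<dots> = poly_value a (kdet Ps (sep_prod X))" by (rule ev.hom_kdet[symmetric])
  \<comment> \<open>Evaluation of all variables at zero is the homomorphism to the integers that
    \<open>kdet_sep_prod\<close> asks for.\<close>
  also have "kdet Ps (sep_prod X) =
      (\<Prod>A\<in>flats (Mat E L). (1 - (\<Prod>e\<in>A. (X e)\<^sup>2)) ^ nat (flat_multiplicity E L A))"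
    using assms(2,3)
    by (intro kdet_sep_prod[OF comm_ring_hom_poly_value[of "\<lambda>_. 0"]])
      (simp_all add: X_def poly_value_variable del: One_nat_def)
  also have "poly_value a \<dots> =
      (\<Prod>A \<in> flats (Mat E L). (1 - (\<Prod>e\<in>A. (U e)\<^sup>2)) ^ nat (flat_multiplicity E L A))"
    unfolding ev.hom_prod
  proof (rule prod.cong[OF refl])
    fix A assume "A \<in> flats (Mat E L)"
    then have "A \<subseteq> E" using zero_set_subset by (auto simp: flats_Mat)
    then have "(\<Prod>e\<in>A. (poly_value a (X e))\<^sup>2) = (\<Prod>e\<in>A. (U e)\<^sup>2)"
      by (intro prod.cong) (auto simp: ev_X)
    then show "poly_value a ((1 - (\<Prod>e\<in>A. (X e)\<^sup>2)) ^ nat (flat_multiplicity E L A)) =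
      (1 - (\<Prod>e\<in>A. (U e)\<^sup>2)) ^ nat (flat_multiplicity E L A)"
      by (simp add: ev.hom_power ev.hom_minus ev.hom_prod)
  qed
  finally show ?thesis .
qed

theorem corollary5p7:
  fixes E :: "'e set" and L :: "'e sign_vector set" and Ps :: "'e sign_vector list"
  assumes "loopless_oriented_matroid E L"
    and "distinct Ps" and "set Ps = topes L"
  shows "(\<forall>A \<in> flats (Mat E L). 0 \<le> flat_multiplicity E L A) \<and>
    det (varchenko_matrix Ps :: ('e, 'k :: field) mpoly mat) =
      (\<Prod>A \<in> flats (Mat E L). (1 - (\<Prod>e\<in>A. (U e)\<^sup>2)) ^ nat (flat_multiplicity E L A)) \<and>
    (\<forall>E' L' Ps'. loopless_oriented_matroid E' L' \<longrightarrow> Mat E' L' = Mat E L \<longrightarrow>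
       distinct Ps' \<longrightarrow> set Ps' = topes L' \<longrightarrow>
       det (varchenko_matrix Ps' :: ('e, 'k) mpoly mat) = det (varchenko_matrix Ps))"
proof (intro conjI ballI allI impI)
  interpret loopless_oriented_matroid E L by fact
  note formula = det_varchenko_matrix[OF assms]
  show "0 \<le> flat_multiplicity E L A" if "A \<in> flats (Mat E L)" for A
    using that by (rule flat_multiplicity_nonneg)
  show "det (varchenko_matrix Ps :: ('e, 'k) mpoly mat) =
      (\<Prod>A \<in> flats (Mat E L). (1 - (\<Prod>e\<in>A. (U e)\<^sup>2)) ^ nat (flat_multiplicity E L A))"
    by (rule formula)
  fix E' :: "'e set" and L' Ps'
  assume L': "loopless_oriented_matroid E' L'" and M: "Mat E' L' = Mat E L"
    and Ps': "distinct Ps'" "set Ps' = topes L'"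
  \<comment> \<open>Equal matroids have equal ground sets, so \<open>flat_multiplicity_eq\<close>
    has the same right-hand side for both.\<close>
  have "E' = E" using M ground_Mat[of E' L'] by simp
  then have "flat_multiplicity E' L' A = flat_multiplicity E L A" if "A \<in> flats (Mat E L)" for A
    using loopless_oriented_matroid.flat_multiplicity_eq[OF L', of A] flat_multiplicity_eq[of A] that M
    by simp
  then show "det (varchenko_matrix Ps' :: ('e, 'k) mpoly mat) = det (varchenko_matrix Ps)"
    unfolding formula det_varchenko_matrix[OF L' Ps'] M by (intro prod.cong) simp_all
qed

end
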